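(* Let $D\subseteq\mathbb R$ be a nonempty open interval, let $m\ge 2$ be an integer, and let $x^*\in D$. Let $J\in C^m(D;\mathbb R)$, put $J^*=J(x^* )$, and suppose there are constants $\alpha_1,\alpha_2,\beta_1,\beta_2>0$ such that for all $x\in D$ $$\alpha_1|x-x^*|^m\le J(x)-J^*\le\alpha_2|x-x^*|^m,$$ $$J^{(m-1)}(x)(x-x^* )\ge\beta_1|x-x^*|^2,\qquad |J^{(m-1)}(x)|\le\beta_2|x-x^*|.$$ Let $g_1,g_2:\mathbb R\to\mathbb R$ be such that $G_1:=g_1\circ J$ and $G_2:=g_2\circ J$ belong to $C^m(D;\mathbb R)$ and, for some constant $c_m>0$, the right-iterated Lie bracket of length $m$ satisfies $$\big[\cdots\big[[G_1,\underbrace{G_2],G_2\big],\dots,G_2}_{m-1\ \text{times}}\big](x)=-c_mJ^{(m-1)}(x)\quad\text{for all }x\in D.$$ For $\varepsilon>0$ let $u_k^\varepsilon(t)=\varepsilon^{\frac1m-1}v_k(t/\varepsilon)$, $k=1,2$, where $v_1,v_2:\mathbb R\to\mathbb R$ are $1$-periodic, measurable, essentially bounded functions not depending on $\varepsilon$ (so that the $u_k^\varepsilon$ are $\varepsilon$-periodic), and suppose that these dithers excite exactly the Lie bracket above at time $t=\varepsilon$, i.e. for all $\varepsilon>0$ and all $x^0\in D$ $$\sum_{\ell=1}^m\ \sum_{k_1,\dots,k_\ell=1}^{2}\big(L_{G_{k_\ell}}\cdots L_{G_{k_2}}G_{k_1}\big)(x^0)\int_0^\varepsilon\!\int_0^{s_1}\!\!\cdots\!\int_0^{s_{\ell-1}}u_{k_1}^\varepsilon(s_1)\cdots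 u_{k_\ell}^\varepsilon(s_\ell)\,ds_\ell\cdots ds_1=\varepsilon\,\big[\cdots\big[[G_1,\underbrace{G_2],G_2\big],\dots,G_2}_{m-1\ \text{times}}\big](x^0).$$ Then the point $x^*$ is semi-globally practically exponentially stable for the extremum seeking system $$\dot x=g_1(J(x))\,u_1^\varepsilon(t)+g_2(J(x))\,u_2^\varepsilon(t).$$
   Context: For scalar functions $f,g$ on $D\subseteq\mathbb R$, the Lie derivative of $f$ along $g$ is $L_gf(x)=\lim_{s\to0}\frac{f(x+sg(x))-f(x)}{s}=f'(x)g(x)$, and the Lie bracket is $[f,g](x)=L_fg(x)-L_gf(x)$. The right-iterated bracket is formed by repeatedly bracketing on the right, e.g. for $m=2$ it is $[G_1,G_2]$, for $m=3$ it is $[[G_1,G_2],G_2]$. For $\ell=1$ the expression $L_{G_{k_\ell}}\cdots L_{G_{k_2}}G_{k_1}$ means $G_{k_1}$. $J^{(\ell)}$ is the $\ell$-th derivative. The left-hand side of the last hypothesis is the Chen--Fliess expansion of $x(\varepsilon)-x^0$ truncated at order $m$; the hypothesis says that $x(\varepsilon)=x^0+\varepsilon\,[\cdots[[G_1,G_2],G_2],\dots,G_2](x^0)+R(\varepsilon)$ with $R$ the Chen--Fliess remainder. Solutions are Carathéodory solutions with $x(0)=x^0$. Semi-global practical exponential stability of $x^*$ (relative to the domain $D$ on which the hypotheses hold): for every $\delta>0$ with $\overline{B_\delta(x^* )}\subset D$ (where $B_\delta(x^* )=\{x:|x-x^*|<\delta\}$) there exist $c>0$ and $\lambda>0$ such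 that for every $\rho\in(0,\delta)$ there exists $\bar\varepsilon>0$ such that for every $\varepsilon\in(0,\bar\varepsilon]$ and every $x^0\in B_\delta(x^* )$ the solution $x(t)$ with $x(0)=x^0$ is defined in $D$ for all $t\ge0$ and satisfies $$|x(t)-x^*|\le c\,|x^0-x^*|\,e^{-\lambda t}+\rho\quad\text{for all }t\ge0.$$ *)

theory Defs
  imports "HOL-Analysis.Analysis"
begin

text \<open>
  \<open>C\<^sup>k\<close> on an open set \<open>D\<close>. Since \<open>D\<close> is open, the iterated \<open>deriv\<close> at a point of \<open>D\<close>
  depends only on the values of \<open>f\<close> on \<open>D\<close>.
\<close>
definition Ck_on :: "nat \<Rightarrow> real set \<Rightarrow> (real \<Rightarrow> real) \<Rightarrow> bool" where
  "Ck_on k D f \<longleftrightarrow>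
     (\<forall>j<k. \<forall>x\<in>D. (deriv ^^ j) f field_differentiable (at x)) \<and>
     continuous_on D ((deriv ^^ k) f)"

text \<open>\<open>lie_deriv g f\<close> is \<open>L\<^sub>g f\<close>: the field comes first, the differentiated function second.\<close>
definition lie_deriv :: "(real \<Rightarrow> real) \<Rightarrow> (real \<Rightarrow> real) \<Rightarrow> real \<Rightarrow> real" where
  "lie_deriv g f x = Lim (at 0) (\<lambda>s. (f (x + s * g x) - f x) / s)"

lemma lie_deriv_eq:
  assumes "f field_differentiable (at x)"
  shows "lie_deriv g f x = deriv f x * g x"
proof -
  have f: "(f has_field_derivative deriv f x) (at (x + 0 * g x))"
    using assms by (simp add: DERIV_deriv_iff_field_differentiable)
  have "((\<lambda>s. x + s * g x) has_field_derivative g x) (at 0)"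
    by (auto intro!: derivative_eq_intros)
  from DERIV_chain2[OF f this]
  have "((\<lambda>s. (f (x + s * g x) - f x) / s) \<longlongrightarrow> deriv f x * g x) (at 0)"
    by (simp add: DERIV_def)
  then show ?thesis
    unfolding lie_deriv_def by (intro tendsto_Lim) auto
qed

definition lie_bracket :: "(real \<Rightarrow> real) \<Rightarrow> (real \<Rightarrow> real) \<Rightarrow> real \<Rightarrow> real" where
  "lie_bracket f g x = lie_deriv f g x - lie_deriv g f x"

text \<open>\<open>[\<cdots>[[f, g], g], \<dots>, g]\<close> with \<open>n\<close> occurrences of \<open>g\<close> (a bracket of length \<open>n + 1\<close>).\<close>
definition right_iterated_bracket ::
    "nat \<Rightarrow> (real \<Rightarrow> real) \<Rightarrow> (real \<Rightarrow> real) \<Rightarrow> real \<Rightarrow> real" where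
  "right_iterated_bracket n f g = ((\<lambda>h. lie_bracket h g) ^^ n) f"

text \<open>
  A multi-index \<open>(k\<^sub>1, \<dots>, k\<^sub>l)\<close> is the list \<open>[k\<^sub>1, \<dots>, k\<^sub>l]\<close>. For this list, \<open>iterated_lie G\<close> is
  \<open>L\<^bsub>G k\<^sub>l\<^esub> \<cdots> L\<^bsub>G k\<^sub>2\<^esub> (G k\<^sub>1)\<close>; the empty list is never used. The factor \<open>u k\<^sub>1 s\<^sub>1\<close> is constant for
  the inner integrals, so \<open>iterated_integral\<close> takes it out of them; the outermost variable
  \<open>s\<^sub>1\<close> goes with \<open>k\<^sub>1\<close>.
\<close>
fun iterated_lie :: "(nat \<Rightarrow> real \<Rightarrow> real) \<Rightarrow> nat list \<Rightarrow> real \<Rightarrow> real" where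
  "iterated_lie G [] = (\<lambda>x. x)"
| "iterated_lie G (k # ks) = fold (\<lambda>j f. lie_deriv (G j) f) ks (G k)"

fun iterated_integral :: "(nat \<Rightarrow> real \<Rightarrow> real) \<Rightarrow> nat list \<Rightarrow> real \<Rightarrow> real" where
  "iterated_integral u [] t = 1"
| "iterated_integral u (k # ks) t =
     (LINT s:{0..t}|lebesgue. u k s * iterated_integral u ks s)"

definition chen_fliess ::
    "nat \<Rightarrow> (nat \<Rightarrow> real \<Rightarrow> real) \<Rightarrow> (nat \<Rightarrow> real \<Rightarrow> real) \<Rightarrow> real \<Rightarrow> real \<Rightarrow> real" where
  "chen_fliess m G u t x0 =
     (\<Sum>l=1..m. \<Sum>ks\<in>{ks. set ks \<subseteq> {1, 2} \<and> length ks = l}.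
        iterated_lie G ks x0 * iterated_integral u ks t)"

definition dither :: "nat \<Rightarrow> (nat \<Rightarrow> real \<Rightarrow> real) \<Rightarrow> real \<Rightarrow> nat \<Rightarrow> real \<Rightarrow> real" where
  "dither m v \<epsilon> k t = \<epsilon> powr (1 / real m - 1) * v k (t / \<epsilon>)"

text \<open>
  Absolute continuity on \<open>[a, b]\<close>: the members of a division are finitely many nonoverlapping
  compact intervals, and \<open>T\<close> is their union.
\<close>
definition absolutely_continuous_on :: "real \<Rightarrow> real \<Rightarrow> (real \<Rightarrow> real) \<Rightarrow> bool" where
  "absolutely_continuous_on a b x \<longleftrightarrow>
     (\<forall>e>0. \<exists>d>0. \<forall>\<D> T. \<D> division_of T \<and> T \<subseteq> {a..b} \<and> (\<Sum>K\<in>\<D>. Sup K - Inf K) < d \<longrightarrow>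
        (\<Sum>K\<in>\<D>. \<bar>x (Sup K) - x (Inf K)\<bar>) < e)"

text \<open>
  Caratheodory solutions of \<open>x' = f t x\<close> with state space \<open>D\<close> on the time interval \<open>I\<close>: locally
  absolutely continuous, and satisfying the equation almost everywhere.
\<close>
definition caratheodory_solution ::
    "(real \<Rightarrow> real \<Rightarrow> real) \<Rightarrow> real set \<Rightarrow> real set \<Rightarrow> (real \<Rightarrow> real) \<Rightarrow> bool" where
  "caratheodory_solution f D I x \<longleftrightarrow>
     (\<forall>t\<in>I. x t \<in> D) \<and>
     (\<forall>a b. {a..b} \<subseteq> I \<longrightarrow> absolutely_continuous_on a b x) \<and>
     (AE t in lebesgue. t \<in> I \<longrightarrow> (x has_real_derivative f t (x t)) (at t within I))"

text \<open>
  \<open>x\<close> is the unique solution with \<open>x 0 = x0\<close>, and it is defined in \<open>D\<close> for all \<open>t \<ge> 0\<close>: it is a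
  global solution, and every solution in \<open>D\<close> on some \<open>[0, T)\<close> with the same initial value is a
  restriction of it.
\<close>
definition global_solution ::
    "(real \<Rightarrow> real \<Rightarrow> real) \<Rightarrow> real set \<Rightarrow> real \<Rightarrow> (real \<Rightarrow> real) \<Rightarrow> bool" where
  "global_solution f D x0 x \<longleftrightarrow>
     caratheodory_solution f D {0..} x \<and> x 0 = x0 \<and>
     (\<forall>T y. caratheodory_solution f D {0..<T} y \<and> y 0 = x0 \<longrightarrow> (\<forall>t\<in>{0..<T}. y t = x t))"

text \<open>\<open>F \<epsilon>\<close> is the time-dependent right-hand side of the system with parameter \<open>\<epsilon>\<close>.\<close>
definition semiglobally_practically_exp_stable ::
    "real set \<Rightarrow> real \<Rightarrow> (real \<Rightarrow> real \<Rightarrow> real \<Rightarrow> real) \<Rightarrow> bool" where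
  "semiglobally_practically_exp_stable D xs F \<longleftrightarrow>
     (\<forall>\<delta>>0. closure (ball xs \<delta>) \<subseteq> D \<longrightarrow>
       (\<exists>c>0. \<exists>\<mu>>0. \<forall>\<rho>\<in>{0<..<\<delta>}. \<exists>\<epsilon>0>0. \<forall>\<epsilon>\<in>{0<..\<epsilon>0}. \<forall>x0\<in>ball xs \<delta>.
          \<exists>x. global_solution (F \<epsilon>) D x0 x \<and>
              (\<forall>t\<ge>0. \<bar>x t - xs\<bar> \<le> c * \<bar>x0 - xs\<bar> * exp (- \<mu> * t) + \<rho>)))"

end

theory Submission
  imports Defs
begin

text \<open>
  Let \<open>\<eta> = \<epsilon> powr (1 / m)\<close>. Iterating the fundamental theorem of calculus along a solution bounds the
  remainder of the Chen--Fliess expansion of order \<open>m\<close> over one period by \<open>A * (2 * B * \<epsilon>) ^ (m + 1)\<close>,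
  where \<open>B\<close> bounds the dithers; as \<open>B * \<epsilon>\<close> is proportional to \<open>\<eta>\<close>, this is \<open>O(\<epsilon> * \<eta>)\<close>. Hence the map
  over one period is a gradient-like step with factor \<open>1 - \<epsilon> * cm * \<beta>1\<close> up to an error \<open>O(\<epsilon> * \<eta>)\<close>, so the
  sampled state decays exponentially down to a residual \<open>O(\<eta>)\<close>, and between two sampling times the state moves by \<open>O(\<eta>)\<close>.
  Solutions are constructed for the field clamped to a compact interval in \<open>D\<close>, which the
  resulting estimates show is never left.
\<close>

text \<open>A Caratheodory solution is given by absolute continuity and an equation holding almost
  everywhere, whereas existence, uniqueness and the expansion all use the integral equation. The two
  theorems of the first section provide the passage in both directions. They are stated for the
  gauge integral, so integrability of the field along an arbitrary competing solution is a
  conclusion and not an assumption.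

  For m > 1 the amplitude of the dithers grows as \<epsilon> shrinks; only amplitude times period is
  small. With \<open>\<eta> ^ m = \<epsilon>\<close>, an error of size \<open>\<eta> ^ m\<close>
  would be comparable to the drift, so the expansion has to reach order m. The errors of all periods
  form a geometric series: dividing R \<epsilon> \<eta> by \<epsilon> \<mu> leaves R \<eta> / \<mu>,
  however many periods have passed.

  Removing the clamp is not circular. One step needs the bound \<delta> only at the start of its
  period, a margin r around the ball absorbs the motion during the period, and the step restores the
  bound \<delta> at the end.

  All this is done for dithers bounded at every time. Essentially bounded ones are truncated at the
  end, which changes neither the solutions nor the iterated integrals.\<close>

section \<open>Absolute continuity and the Henstock--Kurzweil integral\<close>

lemma sum_content_division:
  assumes "\<D> division_of S"
  shows "sum (measure lborel) \<D> = measure lebesgue S"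
proof -
  have "measure lebesgue (\<Union>\<D>) = (\<Sum>K\<in>\<D>. measure lebesgue K)"
  proof (rule measure_negligible_finite_Union)
    show "finite \<D>" using assms by blast
    show "K \<in> lmeasurable" if "K \<in> \<D>" for K
      using cbox_division_memE[OF that assms] by (metis lmeasurable_cbox)
    show "pairwise (\<lambda>K L. negligible (K \<inter> L)) \<D>"
    proof (rule pairwiseI)
      fix K L assume KL: "K \<in> \<D>" "L \<in> \<D>" "K \<noteq> L"
      have "interior K \<inter> interior L = {}"
        using assms KL by (simp add: division_of_def)
      moreover have "convex (K \<inter> L)"
        using KL assms by (metis convex_Int convex_box(1) division_ofD(4))
      ultimately show "negligible (K \<inter> L)"
        by (simp add: negligible_convex_interior)
    qed
  qed
  moreover have "measure lborel K = measure lebesgue K" if "K \<in> \<D>" for K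
    using division_ofD(4)[OF assms that] by (auto simp: measure_completion)
  ultimately show ?thesis
    using division_ofD(6)[OF assms] by simp
qed

text \<open>
  The gauge confines every interval tagged in \<open>N\<close> to an open cover of \<open>N\<close> of small measure, where
  absolute continuity controls the increments of \<open>f\<close>.
\<close>
theorem fundamental_theorem_of_calculus_absolutely_continuous:
  fixes f f' :: "real \<Rightarrow> real"
  assumes "a \<le> b" and ac: "absolutely_continuous_on a b f" and N: "negligible N"
    and der: "\<And>t. t \<in> {a..b} - N \<Longrightarrow> (f has_real_derivative f' t) (at t within {a..b})"
  shows "(f' has_integral (f b - f a)) {a..b}"
proof -
  \<comment> \<open>With the integrand set to 0 on \<open>N\<close>, an interval tagged in
    \<open>N\<close> contributes nothing to the Riemann sum, and only the increment of
    \<open>f\<close> over it is left to be estimated.\<close>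
  define h where "h t = (if t \<in> N then 0 else f' t)" for t
  have "(h has_integral (f b - f a)) (cbox a b)"
    unfolding has_integral
  proof (intro allI impI)
    fix e :: real assume "e > 0"
    \<comment> \<open>Half of \<open>e\<close> is spent on the intervals tagged outside
      \<open>N\<close>, in proportion to their length; the 1 keeps the denominator positive when a =
      b.\<close>
    define e1 where "e1 = e / (2 * (b - a + 1))"
    have "e1 > 0" using \<open>e > 0\<close> \<open>a \<le> b\<close> by (simp add: e1_def)
    from ac \<open>e > 0\<close> obtain \<delta> where "\<delta> > 0" and \<delta>:
      "\<And>\<D> T. \<D> division_of T \<Longrightarrow> T \<subseteq> {a..b} \<Longrightarrow> (\<Sum>K\<in>\<D>. Sup K - Inf K) < \<delta> \<Longrightarrow>
         (\<Sum>K\<in>\<D>. \<bar>f (Sup K) - f (Inf K)\<bar>) < e / 2"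
      unfolding absolutely_continuous_on_def by (meson half_gt_zero)
    have "N \<in> sets lebesgue" using N by (simp add: negligible_iff_null_sets null_setsD2)
    from sets_lebesgue_outer_open[OF this \<open>\<delta> > 0\<close>] obtain U where
      U: "open U" "N \<subseteq> U" "U - N \<in> lmeasurable" "emeasure lebesgue (U - N) < ennreal \<delta>" .
    have Ulm: "U \<in> lmeasurable"
    proof -
      have "U = (U - N) \<union> N" using U(2) by blast
      then show ?thesis using U(3) N by (metis fmeasurable.Un negligible_imp_measurable)
    qed
    have mU: "measure lebesgue U < \<delta>"
    proof -
      have "measure lebesgue U = measure lebesgue (U - N)"
        using N U(2) Ulm by (simp add: measure_Diff_null_set negligible_iff_null_sets)
      moreover have "measure lebesgue (U - N) < \<delta>"
        using U(3,4) by (metis emeasure_eq_measure2 ennreal_less_iff measure_nonneg)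
      ultimately show ?thesis by simp
    qed
    have "\<exists>d>0. (t \<in> N \<longrightarrow> ball t d \<subseteq> U) \<and> (t \<in> {a..b} - N \<longrightarrow>
        (\<forall>y\<in>{a..b}. \<bar>y - t\<bar> < d \<longrightarrow> \<bar>f y - f t - (y - t) * f' t\<bar> \<le> e1 * \<bar>y - t\<bar>))" for t
    proof (cases "t \<in> N")
      case True
      then show ?thesis using U(1,2) by (meson Diff_iff openE subsetD)
    next
      case False
      show ?thesis
      proof (cases "t \<in> {a..b}")
        case True
        then have "(f has_derivative (*) (f' t)) (at t within {a..b})"
          using der[of t] False by (simp add: has_field_derivative_def)
        then obtain d where "d > 0"
          "\<forall>y\<in>{a..b}. norm (y - t) < d \<longrightarrow> norm (f y - f t - f' t * (y - t)) \<le> e1 * norm (y - t)"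
          unfolding has_derivative_within_alt using \<open>e1 > 0\<close> by blast
        then show ?thesis using False by (auto simp: mult.commute)
      qed (use False in \<open>auto intro: exI[of _ 1]\<close>)
    qed
    then obtain d where d: "\<And>t. d t > 0" "\<And>t. t \<in> N \<Longrightarrow> ball t (d t) \<subseteq> U"
      "\<And>t y. t \<in> {a..b} - N \<Longrightarrow> y \<in> {a..b} \<Longrightarrow> \<bar>y - t\<bar> < d t \<Longrightarrow>
         \<bar>f y - f t - (y - t) * f' t\<bar> \<le> e1 * \<bar>y - t\<bar>"
      by metis
    show "\<exists>\<gamma>. gauge \<gamma> \<and> (\<forall>p. p tagged_division_of cbox a b \<and> \<gamma> fine p \<longrightarrow>
       norm ((\<Sum>(x, K)\<in>p. measure lborel K *\<^sub>R h x) - (f b - f a)) < e)"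
    proof (intro exI conjI allI impI; (elim conjE)?)
      show "gauge (\<lambda>t. ball t (d t))" using d(1) by (rule gauge_ball_dependent[rule_format])
      fix p assume p: "p tagged_division_of cbox a b" and fine: "(\<lambda>t. ball t (d t)) fine p"
      define p2 where "p2 = {(t, K) \<in> p. t \<in> N}"
      have "finite p" using p by blast
      have memp: "\<exists>u v. K = {u..v} \<and> u \<le> v \<and> t \<in> {u..v} \<and> a \<le> u \<and> v \<le> b \<and> {u..v} \<subseteq> ball t (d t)"
        if tK: "(t, K) \<in> p" for t K
      proof -
        obtain u v where K: "K = cbox u v" using p tK by blast
        have "t \<in> K" "K \<subseteq> cbox a b" using p tK by blast+
        moreover have "K \<subseteq> ball t (d t)" using fine tK by (auto simp: fine_def)
        ultimately show ?thesis using K by (intro exI[of _ u] exI[of _ v]) auto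
      qed
      have p2part: "p2 tagged_partial_division_of cbox a b"
        by (rule tagged_partial_division_subset[of p])
           (use p in \<open>auto simp: p2_def tagged_division_of_def\<close>)
      note p2div = tagged_partial_division_of_Union_self[OF p2part]
      have div: "snd ` p2 division_of \<Union>(snd ` p2)"
        using p2div by (rule division_of_tagged_division)
      have ba: "b - a = (\<Sum>(x,K)\<in>p. Sup K - Inf K)" "f b - f a = (\<Sum>(x,K)\<in>p. f(Sup K) - f(Inf K))"
        using additive_tagged_division_1[where f= "\<lambda>x. x"] additive_tagged_division_1[where f= f]
              \<open>a \<le> b\<close> p by auto
      \<comment> \<open>Passing from tagged pairs to their intervals is safe because an interval
        carrying two tags must be degenerate. The lemma for this wants a function vanishing on
        degenerate boxes, and the empty box needs its own value since \<open>Sup\<close> and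
        \<open>Inf\<close> say nothing there.\<close>
      define \<phi> where "\<phi> K = (if K = {} then 0 else \<bar>f (Sup K) - f (Inf K)\<bar>)" for K
      have ne: "K \<noteq> {}" if "(t, K) \<in> p2" for t K
        using that memp by (fastforce simp: p2_def)
      have "(\<Sum>(t,K)\<in>p2. \<bar>f (Sup K) - f (Inf K)\<bar>) = (\<Sum>(t,K)\<in>p2. \<phi> K)"
        by (rule sum.cong) (use ne in \<open>auto simp: \<phi>_def\<close>)
      also have "\<dots> = (\<Sum>K\<in>snd ` p2. \<phi> K)"
      proof (rule sum.over_tagged_division_lemma[OF p2div])
        fix u v :: real assume "box u v = {}"
        then show "\<phi> (cbox u v) = 0"
          by (cases "u = v") (auto simp: \<phi>_def)
      qed
      also have "\<dots> = (\<Sum>K\<in>snd ` p2. \<bar>f (Sup K) - f (Inf K)\<bar>)"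
        by (rule sum.cong) (use ne in \<open>auto simp: \<phi>_def\<close>)
      also have "\<dots> < e / 2"
      proof (rule \<delta>[OF div])
        show "\<Union>(snd ` p2) \<subseteq> {a..b}"
          using p2part by (force simp: tagged_partial_division_of_def)
        have "(\<Sum>K\<in>snd ` p2. Sup K - Inf K) = sum (measure lborel) (snd ` p2)"
        proof (rule sum.cong)
          fix K assume "K \<in> snd ` p2"
          then obtain t where "(t, K) \<in> p" by (auto simp: p2_def)
          from memp[OF this] show "Sup K - Inf K = measure lborel K" by auto
        qed auto
        also have "\<dots> = measure lebesgue (\<Union>(snd ` p2))" by (rule sum_content_division[OF div])
        also have "\<dots> \<le> measure lebesgue U"
        proof (rule measure_mono_fmeasurable)
          show "\<Union>(snd ` p2) \<subseteq> U"
          proof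
            fix x assume "x \<in> \<Union>(snd ` p2)"
            then obtain t K where "(t, K) \<in> p" "t \<in> N" "x \<in> K" by (auto simp: p2_def)
            with memp[of t K] d(2)[of t] show "x \<in> U" by blast
          qed
          show "\<Union>(snd ` p2) \<in> sets lebesgue"
            using lmeasurable_division[OF div] by auto
        qed (rule Ulm)
        finally show "(\<Sum>K\<in>snd ` p2. Sup K - Inf K) < \<delta>" using mU by simp
      qed
      finally have part2: "(\<Sum>(t,K)\<in>p2. \<bar>f (Sup K) - f (Inf K)\<bar>) < e / 2" .
      have bound: "\<bar>measure lborel K * h t - (f (Sup K) - f (Inf K))\<bar> \<le>
          e1 * (Sup K - Inf K) + (if t \<in> N then \<bar>f (Sup K) - f (Inf K)\<bar> else 0)"
        if tK: "(t, K) \<in> p" for t K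
      proof -
        obtain u v where K: "K = {u..v}" "u \<le> v" "t \<in> {u..v}" "a \<le> u" "v \<le> b"
          "{u..v} \<subseteq> ball t (d t)" using memp[OF tK] by blast
        then have SI: "Sup K = v" "Inf K = u" "measure lborel K = v - u" by auto
        show ?thesis
        proof (cases "t \<in> N")
          case True
          have "0 \<le> e1 * (v - u)" using K \<open>e1 > 0\<close> by simp
          then show ?thesis using True by (simp add: h_def SI)
        next
          case False
          have uv: "u \<in> ball t (d t)" "v \<in> ball t (d t)" using K(2,6) by auto
          have "\<bar>f u - f t - (u - t) * f' t\<bar> \<le> e1 * \<bar>u - t\<bar>"
            by (rule d(3)) (use K False uv in \<open>auto simp: dist_real_def\<close>)
          moreover have "\<bar>f v - f t - (v - t) * f' t\<bar> \<le> e1 * \<bar>v - t\<bar>"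
            by (rule d(3)) (use K False uv in \<open>auto simp: dist_real_def\<close>)
          \<comment> \<open>Straddle estimate: since the tag lies between the endpoints, the two
            endpoint errors add up to \<open>e1\<close> times the length.\<close>
          moreover have "e1 * \<bar>u - t\<bar> + e1 * \<bar>v - t\<bar> = e1 * (v - u)"
            using K(3) by (simp add: algebra_simps)
          moreover have "(v - u) * f' t - (f v - f u) =
            (f u - f t - (u - t) * f' t) - (f v - f t - (v - t) * f' t)"
            by (simp add: algebra_simps)
          ultimately show ?thesis using False by (simp add: h_def SI)
        qed
      qed
      have "norm ((\<Sum>(x, K)\<in>p. measure lborel K *\<^sub>R h x) - (f b - f a)) =
        \<bar>\<Sum>(t,K)\<in>p. measure lborel K * h t - (f (Sup K) - f (Inf K))\<bar>"
        unfolding ba(2) by (simp add: sum_subtractf split_def)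
      also have "\<dots> \<le> (\<Sum>(t,K)\<in>p. \<bar>measure lborel K * h t - (f (Sup K) - f (Inf K))\<bar>)"
        by (simp add: split_def sum_abs)
      also have "\<dots> \<le> (\<Sum>(t,K)\<in>p. e1 * (Sup K - Inf K) + (if t \<in> N then \<bar>f (Sup K) - f (Inf K)\<bar> else 0))"
        by (rule sum_mono) (use bound in auto)
      also have "\<dots> = e1 * (b - a) + (\<Sum>(t,K)\<in>p2. \<bar>f (Sup K) - f (Inf K)\<bar>)"
        unfolding ba(1) p2_def split_def using \<open>finite p\<close>
        by (simp add: sum.distrib sum_distrib_left sum.inter_filter)
      also have "\<dots> < e1 * (b - a) + e / 2" using part2 by simp
      also have "e1 * (b - a) \<le> e / 2"
        using \<open>e > 0\<close> \<open>a \<le> b\<close> by (simp add: e1_def field_simps)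
      finally show "norm ((\<Sum>(x, K)\<in>p. measure lborel K *\<^sub>R h x) - (f b - f a)) < e" by simp
    qed
  qed
  then have "(h has_integral (f b - f a)) {a..b}" by simp
  then show ?thesis
    by (rule has_integral_spike[OF N, rotated]) (simp add: h_def)
qed

text \<open>
  Intervals on which the difference quotient at an endpoint is off by at least \<open>\<eta>\<close> form a Vitali
  cover of the exceptional set, and Henstock's lemma bounds the total length of disjoint ones.
\<close>
theorem indefinite_integral_has_derivative_ae:
  fixes f :: "real \<Rightarrow> real"
  assumes int: "f integrable_on {a..b}"
  shows "negligible {t \<in> {a..b}.
    \<not> ((\<lambda>s. integral {a..s} f) has_real_derivative f t) (at t within {a..b})}"
proof -
  define F where "F t = integral {a..t} f" for t
  define bad where "bad \<eta> t y \<longleftrightarrow> y \<in> {a..b} \<and> \<eta> * \<bar>y - t\<bar> < \<bar>F y - F t - f t * (y - t)\<bar>" for \<eta> t y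
  define E where "E \<eta> = {t \<in> {a..b}. \<forall>d>0. \<exists>y. bad \<eta> t y \<and> \<bar>y - t\<bar> < d}" for \<eta>
  have Fdiff: "F v - F u = integral {u..v} f" if "a \<le> u" "u \<le> v" "v \<le> b" for u v
  proof -
    have "integral {a..u} f + integral {u..v} f = integral {a..v} f"
      by (rule Henstock_Kurzweil_Integration.integral_combine) (use that in \<open>auto intro: integrable_subinterval_real[OF int]\<close>)
    then show ?thesis by (simp add: F_def)
  qed
  have negl: "negligible (E \<eta>)" if "\<eta> > 0" for \<eta>
    unfolding negligible_outer_le
  proof (intro allI impI)
    fix e :: real assume "e > 0"
    have "e * \<eta> > 0" using \<open>e > 0\<close> that by simp
    have int': "f integrable_on cbox a b" using int by simp
    obtain \<gamma> where \<gamma>: "gauge \<gamma>" "\<And>p. p tagged_partial_division_of (cbox a b) \<Longrightarrow> \<gamma> fine p \<Longrightarrow>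
             sum (\<lambda>(x,k). norm (measure lborel k *\<^sub>R f x - integral k f)) p < e * \<eta>"
      using Henstock_lemma[OF int' \<open>e * \<eta> > 0\<close>] by blast
    \<comment> \<open>The cover is indexed by pairs of a tag t and a bad point y. The interval
      between them is also written as a ball with centre \<open>c\<close> and radius
      \<open>r\<close>, the form that the Vitali theorem takes.\<close>
    define I where "I = (\<lambda>(t, y). {min t y..max t y :: real})"
    define c where "c = (\<lambda>(t, y). (t + y) / 2 :: real)"
    define r where "r = (\<lambda>(t, y). \<bar>y - t\<bar> / 2 :: real)"
    define K where "K = {(t, y). t \<in> {a..b} \<and> bad \<eta> t y \<and> I (t, y) \<subseteq> \<gamma> t}"
    have cb: "cball (c i) (r i) = I i" for i
      by (cases i) (auto simp: c_def r_def I_def dist_real_def abs_le_iff min_def max_def field_simps)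
    have bne: "y \<noteq> t" if "bad \<eta> t y" for t y using that by (auto simp: bad_def)
    have r: "0 < r i" if "i \<in> K" for i
      using that bne by (force simp: K_def r_def)
    have S: "\<exists>i. i \<in> K \<and> t \<in> cball (c i) (r i) \<and> r i < d" if t: "t \<in> E \<eta>" and "0 < d" for t d
    proof -
      obtain d' where d': "d' > 0" "ball t d' \<subseteq> \<gamma> t" using \<gamma>(1) by (meson gaugeD openE)
      have "min d d' > 0" using \<open>0 < d\<close> d' by simp
      then obtain y where y: "bad \<eta> t y" "\<bar>y - t\<bar> < min d d'" using t unfolding E_def by blast
      have "I (t, y) \<subseteq> ball t d'" using y(2) by (auto simp: I_def dist_real_def)
      then have "(t, y) \<in> K" using y t d'(2) by (auto simp: K_def E_def)
      moreover have "t \<in> cball (c (t, y)) (r (t, y))" unfolding cb by (auto simp: I_def)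
      moreover have "r (t, y) < d" using y(2) bne[OF y(1)] by (auto simp: r_def)
      ultimately show ?thesis by blast
    qed
    obtain C where C: "countable C" "C \<subseteq> K"
       "pairwise (\<lambda>i j. disjnt (cball (c i) (r i)) (cball (c j) (r j))) C"
       "negligible (E \<eta> - (\<Union>i\<in>C. cball (c i) (r i)))"
      by (rule Vitali_covering_theorem_cballs[of K r "E \<eta>" c]) (use r S in auto)
    have fin: "measure lebesgue (\<Union>i\<in>C'. I i) \<le> e" if C': "C' \<subseteq> C" "finite C'" for C'
    proof -
      define p where "p = (\<lambda>i. (fst i, I i)) ` C'"
      have inI: "inj_on (\<lambda>i. (fst i, I i)) C'"
      proof (rule inj_onI)
        fix i j assume ij: "i \<in> C'" "j \<in> C'" "(fst i, I i) = (fst j, I j)"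
        show "i = j"
        proof (rule ccontr)
          assume "i \<noteq> j"
          then have "disjnt (I i) (I j)" using C(3) ij C'(1) unfolding pairwise_def cb by blast
          then show False using ij(3) by (cases i; cases j) (auto simp: disjnt_def I_def)
        qed
      qed
      have "p tagged_partial_division_of cbox a b"
        unfolding tagged_partial_division_of_def
      proof (intro conjI allI impI; (elim conjE)?)
        show "finite p" using C' by (simp add: p_def)
        fix x k assume xk: "(x, k) \<in> p"
        then obtain i where i: "i \<in> C'" "x = fst i" "k = I i" by (auto simp: p_def)
        then have "i \<in> K" using C C' by blast
        show "x \<in> k" using i by (cases i) (auto simp: I_def)
        show "k \<subseteq> cbox a b" using i \<open>i \<in> K\<close> by (cases i) (auto simp: I_def K_def bad_def)
        show "\<exists>a b. k = cbox a b" using i by (cases i) (auto simp: I_def)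
        fix x2 k2 assume xk2: "(x2, k2) \<in> p" and ne: "(x, k) \<noteq> (x2, k2)"
        then obtain j where j: "j \<in> C'" "x2 = fst j" "k2 = I j" by (auto simp: p_def)
        with i ne have "i \<noteq> j" by auto
        then have "disjnt (I i) (I j)" using C(3) i j C'(1) unfolding pairwise_def cb by blast
        then show "interior k \<inter> interior k2 = {}"
          using i j interior_subset by (force simp: disjnt_def)
      qed
      moreover have "\<gamma> fine p"
        using C C' by (fastforce simp: fine_def p_def K_def)
      ultimately have "sum (\<lambda>(x,k). norm (measure lborel k *\<^sub>R f x - integral k f)) p < e * \<eta>"
        by (rule \<gamma>(2))
      then have lt: "(\<Sum>i\<in>C'. \<bar>measure lborel (I i) * f (fst i) - integral (I i) f\<bar>) < e * \<eta>"
        unfolding p_def by (subst (asm) sum.reindex[OF inI]) simp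
      \<comment> \<open>Badness of the pair says that its term in the Henstock sum exceeds \<eta>
        times the length of the interval. As the sum stays below \<open>e * \<eta>\<close>, the
        lengths add up to at most \<open>e\<close>.\<close>
      have "\<eta> * measure lborel (I i) \<le> \<bar>measure lborel (I i) * f (fst i) - integral (I i) f\<bar>" if "i \<in> C'" for i
      proof -
        obtain t y where i: "i = (t, y)" by (cases i)
        have "i \<in> K" using that C C' by blast
        then have ty: "t \<in> {a..b}" "y \<in> {a..b}" "\<eta> * \<bar>y - t\<bar> < \<bar>F y - F t - f t * (y - t)\<bar>"
          by (auto simp: K_def bad_def i)
        show ?thesis
        proof (cases "t \<le> y")
          case True
          then have "F y - F t = integral {t..y} f" using ty by (intro Fdiff) auto
          then show ?thesis using ty(3) True by (simp add: i I_def algebra_simps)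
        next
          case False
          then have "F t - F y = integral {y..t} f" using ty by (intro Fdiff) auto
          then have "\<bar>F y - F t - f t * (y - t)\<bar> = \<bar>(t - y) * f t - integral {y..t} f\<bar>"
            by (simp add: algebra_simps)
          then show ?thesis using ty(3) False by (simp add: i I_def)
        qed
      qed
      then have "(\<Sum>i\<in>C'. \<eta> * measure lborel (I i)) \<le> (\<Sum>i\<in>C'. \<bar>measure lborel (I i) * f (fst i) - integral (I i) f\<bar>)"
        by (rule sum_mono)
      with lt have "\<eta> * (\<Sum>i\<in>C'. measure lborel (I i)) < \<eta> * e" by (simp add: sum_distrib_left mult.commute)
      then have le: "(\<Sum>i\<in>C'. measure lborel (I i)) \<le> e" using \<open>\<eta> > 0\<close> by simp
      have "measure lebesgue (\<Union>i\<in>C'. I i) \<le> (\<Sum>i\<in>C'. measure lebesgue (I i))"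
        using C'(2) by (rule measure_UNION_le) (auto simp: I_def split_def)
      also have "\<dots> = (\<Sum>i\<in>C'. measure lborel (I i))" by (simp add: I_def split_def)
      finally show ?thesis using le by simp
    qed
    have lm: "I i \<in> lmeasurable" for i by (simp add: I_def split_def)
    define T where "T = (E \<eta> - (\<Union>i\<in>C. I i)) \<union> (\<Union>i\<in>C. I i)"
    have nn: "negligible (E \<eta> - (\<Union>i\<in>C. I i))" using C(4) by (simp add: cb)
    \<comment> \<open>A bound valid for all finite subfamilies passes to the countable
      union.\<close>
    have UC: "(\<Union>i\<in>C. I i) \<in> lmeasurable" "measure lebesgue (\<Union>i\<in>C. I i) \<le> e"
      using fmeasurable_UN_bound[OF C(1), of I lebesgue e] measure_UN_bound[OF C(1), of I lebesgue e]
        lm fin by auto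
    show "\<exists>T. E \<eta> \<subseteq> T \<and> T \<in> lmeasurable \<and> measure lebesgue T \<le> e"
    proof (intro exI[of _ T] conjI)
      show "E \<eta> \<subseteq> T" by (auto simp: T_def)
      show "T \<in> lmeasurable" unfolding T_def using nn UC(1)
        by (intro fmeasurable.Un) (auto intro: negligible_imp_measurable)
      have "measure lebesgue T \<le> measure lebesgue (E \<eta> - (\<Union>i\<in>C. I i)) + measure lebesgue (\<Union>i\<in>C. I i)"
        unfolding T_def using nn UC(1)
        by (intro measure_Un_le) (auto intro: negligible_imp_measurable fmeasurableD)
      then show "measure lebesgue T \<le> e" using nn UC(2) by (simp add: negligible_imp_measure0)
    qed
  qed
  have "negligible (\<Union>n. E (1 / real (Suc n)))"
    by (rule negligible_Union_nat) (simp add: negl)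
  moreover have "{t \<in> {a..b}. \<not> (F has_real_derivative f t) (at t within {a..b})} \<subseteq> (\<Union>n. E (1 / real (Suc n)))"
  proof (rule subsetI, rule ccontr)
    fix t assume t: "t \<in> {t \<in> {a..b}. \<not> (F has_real_derivative f t) (at t within {a..b})}"
      and nt: "t \<notin> (\<Union>n. E (1 / real (Suc n)))"
    have "(F has_derivative (*) (f t)) (at t within {a..b})"
      unfolding has_derivative_within_alt
    proof (intro conjI allI impI)
      show "bounded_linear ((*) (f t))" by (rule bounded_linear_mult_right)
      fix e :: real assume "e > 0"
      then obtain n where n: "1 / real (Suc n) < e" using nat_approx_posE by blast
      have "t \<notin> E (1 / real (Suc n))" using nt by blast
      then obtain d where "d > 0" and d: "\<And>y. bad (1 / real (Suc n)) t y \<Longrightarrow> \<not> \<bar>y - t\<bar> < d"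
        using t unfolding E_def by blast
      have "norm (F y - F t - f t * (y - t)) \<le> e * norm (y - t)"
        if "y \<in> {a..b}" "norm (y - t) < d" for y
      proof -
        have "\<not> bad (1 / real (Suc n)) t y" using d that(2) by force
        then have "\<bar>F y - F t - f t * (y - t)\<bar> \<le> 1 / real (Suc n) * \<bar>y - t\<bar>"
          using that(1) unfolding bad_def not_less[symmetric] by blast
        also have "\<dots> \<le> e * \<bar>y - t\<bar>" using n by (intro mult_right_mono) auto
        finally show ?thesis by simp
      qed
      then show "\<exists>d>0. \<forall>y\<in>{a..b}. norm (y - t) < d \<longrightarrow> norm (F y - F t - f t * (y - t)) \<le> e * norm (y - t)"
        using \<open>d > 0\<close> by blast
    qed
    then show False using t by (simp add: has_field_derivative_def)
  qed
  ultimately show ?thesis unfolding F_def by (rule negligible_subset)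
qed

section \<open>Caratheodory equations\<close>

lemma AE_lebesgue_negligible:
  "(AE t in lebesgue. P t) \<longleftrightarrow> negligible {t. \<not> P t}"
proof
  assume "AE t in lebesgue. P t"
  then obtain N where "{t \<in> space lebesgue. \<not> P t} \<subseteq> N" "N \<in> null_sets lebesgue"
    by (auto elim: AE_E simp: null_sets_def)
  then show "negligible {t. \<not> P t}"
    by (metis (no_types, lifting) Collect_cong UNIV_I negligible_iff_null_sets negligible_subset
        space_completion space_lborel space_borel)
next
  assume "negligible {t. \<not> P t}"
  then show "AE t in lebesgue. P t"
    by (intro AE_I'[of "{t. \<not> P t}"]) (auto simp: negligible_iff_null_sets)
qed

lemma absolutely_continuous_on_lipschitz:
  assumes "M \<ge> 0" and lip: "\<And>s t. s \<in> {a..b} \<Longrightarrow> t \<in> {a..b} \<Longrightarrow> \<bar>x s - x t\<bar> \<le> M * \<bar>s - t\<bar>"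
  shows "absolutely_continuous_on a b x"
  unfolding absolutely_continuous_on_def
proof (intro allI impI)
  fix e :: real assume "e > 0"
  show "\<exists>d>0. \<forall>\<D> T. \<D> division_of T \<and> T \<subseteq> {a..b} \<and> (\<Sum>K\<in>\<D>. Sup K - Inf K) < d \<longrightarrow>
        (\<Sum>K\<in>\<D>. \<bar>x (Sup K) - x (Inf K)\<bar>) < e"
  proof (intro exI[of _ "e / (M + 1)"] conjI allI impI; (elim conjE)?)
    show "e / (M + 1) > 0" using \<open>e > 0\<close> \<open>M \<ge> 0\<close> by simp
    fix \<D> T assume div: "\<D> division_of T" and T: "T \<subseteq> {a..b}"
      and small: "(\<Sum>K\<in>\<D>. Sup K - Inf K) < e / (M + 1)"
    have K: "\<bar>x (Sup K) - x (Inf K)\<bar> \<le> M * (Sup K - Inf K)" "0 \<le> Sup K - Inf K" if KD: "K \<in> \<D>" for K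
    proof -
      obtain u v where uv: "K = cbox u v" "K \<noteq> {}" "K \<subseteq> T"
        using division_ofD(2-4)[OF div KD] by metis
      then have "u \<le> v" "Sup K = v" "Inf K = u" by auto
      moreover have "u \<in> K" "v \<in> K" using uv(1) \<open>u \<le> v\<close> by auto
      then have "u \<in> {a..b}" "v \<in> {a..b}" using uv(3) T by blast+
      ultimately show "\<bar>x (Sup K) - x (Inf K)\<bar> \<le> M * (Sup K - Inf K)" "0 \<le> Sup K - Inf K"
        using lip[of v u] by auto
    qed
    have "(\<Sum>K\<in>\<D>. \<bar>x (Sup K) - x (Inf K)\<bar>) \<le> (\<Sum>K\<in>\<D>. M * (Sup K - Inf K))"
      by (rule sum_mono) (use K in auto)
    also have "\<dots> = M * (\<Sum>K\<in>\<D>. Sup K - Inf K)" by (simp add: sum_distrib_left)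
    also have "\<dots> \<le> (M + 1) * (\<Sum>K\<in>\<D>. Sup K - Inf K)"
      by (intro mult_right_mono sum_nonneg) (use K in auto)
    also have "\<dots> < e" using small \<open>M \<ge> 0\<close> by (simp add: field_simps)
    finally show "(\<Sum>K\<in>\<D>. \<bar>x (Sup K) - x (Inf K)\<bar>) < e" .
  qed
qed

section \<open>Integral equations with bounded measurable inputs\<close>

lemma integrable_continuous_mult_bounded:
  fixes \<phi> u :: "real \<Rightarrow> real"
  assumes \<phi>: "continuous_on {a..b} \<phi>" and u: "u \<in> borel_measurable lebesgue" and B: "\<And>t. \<bar>u t\<bar> \<le> B"
  shows "(\<lambda>s. u s * \<phi> s) absolutely_integrable_on {a..b}" "(\<lambda>s. u s * \<phi> s) integrable_on {a..b}"
proof -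
  have "(\<lambda>s. u s * \<phi> s) \<in> borel_measurable (lebesgue_on {a..b})"
    using \<phi>
    by (intro borel_measurable_times measurable_restrict_space1[OF u]
          continuous_imp_measurable_on_sets_lebesgue) auto
  moreover have "(\<lambda>s. B * \<bar>\<phi> s\<bar>) integrable_on {a..b}"
    by (intro integrable_continuous_real continuous_intros \<phi>)
  moreover have "norm (u s * \<phi> s) \<le> B * \<bar>\<phi> s\<bar>" for s
    using B[of s] by (simp add: abs_mult mult_right_mono)
  ultimately show "(\<lambda>s. u s * \<phi> s) absolutely_integrable_on {a..b}"
    by (intro measurable_bounded_by_integrable_imp_absolutely_integrable) auto
  then show "(\<lambda>s. u s * \<phi> s) integrable_on {a..b}"
    using set_lebesgue_integral_eq_integral(1) by blast
qed

lemma abs_integral_le_const: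
  fixes h :: "real \<Rightarrow> real"
  assumes "h integrable_on {a..b}" "a \<le> b" "\<And>t. t \<in> {a..b} \<Longrightarrow> \<bar>h t\<bar> \<le> M"
  shows "\<bar>integral {a..b} h\<bar> \<le> M * (b - a)"
proof -
  have "norm (integral {a..b} h) \<le> integral {a..b} (\<lambda>t. M)"
    by (rule integral_norm_bound_integral) (use assms in auto)
  then show ?thesis using assms(2) by (simp add: mult.commute)
qed

lemma indefinite_integral_lipschitz:
  fixes h :: "real \<Rightarrow> real"
  assumes int: "h integrable_on {0..T}" and M: "\<And>t. t \<in> {0..T} \<Longrightarrow> \<bar>h t\<bar> \<le> M"
    and st: "s \<in> {0..T}" "t \<in> {0..T}"
  shows "\<bar>integral {0..s} h - integral {0..t} h\<bar> \<le> M * \<bar>s - t\<bar>"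
proof -
  have "\<bar>integral {0..t} h - integral {0..s} h\<bar> \<le> M * (t - s)" if "0 \<le> s" "s \<le> t" "t \<le> T" for s t
  proof -
    have i: "h integrable_on {0..t}" "h integrable_on {s..t}"
      using that by (auto intro: integrable_subinterval_real[OF int])
    have "integral {0..s} h + integral {s..t} h = integral {0..t} h"
      by (rule Henstock_Kurzweil_Integration.integral_combine) (use that i in auto)
    moreover have "\<bar>integral {s..t} h\<bar> \<le> M * (t - s)"
      by (rule abs_integral_le_const) (use that i M in auto)
    ultimately show ?thesis by linarith
  qed
  from this[of s t] this[of t s] st show ?thesis
    by (cases "s \<le> t") (auto simp: abs_minus_commute)
qed

lemma exp_has_integral:
  fixes c :: real
  assumes "c \<noteq> 0" "0 \<le> t"
  shows "((\<lambda>s. exp (c * s)) has_integral ((exp (c * t) - 1) / c)) {0..t}"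
proof -
  have "((\<lambda>s. exp (c * s)) has_integral (exp (c * t) / c - exp (c * 0) / c)) {0..t}"
    by (rule fundamental_theorem_of_calculus)
       (use assms in \<open>auto intro!: derivative_eq_intros
          simp flip: has_real_derivative_iff_has_vector_derivative\<close>)
  then show ?thesis by (simp add: diff_divide_distrib)
qed

lemma continuous_on_lipschitz_real:
  fixes f :: "real \<Rightarrow> real"
  assumes "\<And>s t. s \<in> S \<Longrightarrow> t \<in> S \<Longrightarrow> \<bar>f s - f t\<bar> \<le> M * \<bar>s - t\<bar>"
  shows "continuous_on S f"
proof (rule lipschitz_on_continuous_on)
  show "\<bar>M\<bar>-lipschitz_on S f"
  proof (rule lipschitz_onI)
    fix s t assume "s \<in> S" "t \<in> S"
    then have "\<bar>f s - f t\<bar> \<le> M * \<bar>s - t\<bar>" by (rule assms)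
    also have "\<dots> \<le> \<bar>M\<bar> * \<bar>s - t\<bar>" by (rule mult_right_mono) auto
    finally show "dist (f s) (f t) \<le> \<bar>M\<bar> * dist s t" by (simp add: dist_real_def)
  qed auto
qed

text \<open>
  The Picard operator is a contraction on the whole half-line once paths are weighted by
  \<open>exp (- 2 * L * t)\<close>.
\<close>
lemma integral_equation_exists:
  fixes F :: "real \<Rightarrow> real \<Rightarrow> real"
  assumes int: "\<And>T y. continuous_on {0..T} y \<Longrightarrow> (\<lambda>s. F s (y s)) integrable_on {0..T}"
    and bd: "\<And>s z. \<bar>F s z\<bar> \<le> M"
    and lip: "\<And>s z z'. \<bar>F s z - F s z'\<bar> \<le> L * \<bar>z - z'\<bar>" and "L > 0"
  shows "\<exists>x. continuous_on UNIV x \<and> (\<forall>t\<ge>0. x t = x0 + integral {0..t} (\<lambda>s. F s (x s)))"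
proof -
  define A where "A = 2 * L"
  have "A > 0" using \<open>L > 0\<close> by (simp add: A_def)
  have "M \<ge> 0" using bd[of 0 0] by linarith
  \<comment> \<open>A path is encoded by the bounded continuous function that remains after
    subtracting \<open>x0\<close> and dividing by the weight, so the weighted norm becomes the
    supremum norm of a complete space.\<close>
  define X where "X w s = x0 + exp (A * s) * apply_bcontfun w s" for w :: "real \<Rightarrow>\<^sub>C real" and s
  \<comment> \<open>The functions of this type live on the whole line; \<open>max 0 t\<close>
    freezes the operator for negative times.\<close>
  define P where "P w t = exp (- A * max 0 t) * integral {0..max 0 t} (\<lambda>s. F s (X w s))" for w t
  have contX: "continuous_on S (X w)" for w S
    unfolding X_def by (intro continuous_intros continuous_on_apply_bcontfun)
  have intX: "(\<lambda>s. F s (X w s)) integrable_on {0..T}" for w T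
    by (rule int[OF contX])
  have contI: "continuous_on {0..} (\<lambda>t. integral {0..t} (\<lambda>s. F s (X w s)))" for w
  proof (rule continuous_on_lipschitz_real)
    fix s t :: real assume "s \<in> {0..}" "t \<in> {0..}"
    then show "\<bar>integral {0..s} (\<lambda>s. F s (X w s)) - integral {0..t} (\<lambda>s. F s (X w s))\<bar> \<le> M * \<bar>s - t\<bar>"
      by (intro indefinite_integral_lipschitz[OF intX[of w "max s t"]]) (auto simp: bd)
  qed
  have Pb: "P w \<in> bcontfun" for w
    unfolding bcontfun_def
  proof (intro CollectI conjI)
    have "continuous_on UNIV (\<lambda>t. integral {0..max 0 t} (\<lambda>s. F s (X w s)))"
      by (rule continuous_on_compose2[OF contI]) (auto intro!: continuous_intros)
    then show "continuous_on UNIV (P w)" unfolding P_def by (intro continuous_intros)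
    show "bounded (range (P w))"
    proof (rule boundedI)
      fix z assume "z \<in> range (P w)"
      then obtain t where z: "z = P w t" by blast
      define \<tau> where "\<tau> = max 0 t"
      have "\<tau> \<ge> 0" by (simp add: \<tau>_def)
      have "\<bar>integral {0..\<tau>} (\<lambda>s. F s (X w s))\<bar> \<le> M * (\<tau> - 0)"
        by (rule abs_integral_le_const) (use intX bd \<open>\<tau> \<ge> 0\<close> in auto)
      then have "norm z \<le> exp (- A * \<tau>) * (M * \<tau>)"
        by (simp add: z P_def abs_mult flip: \<tau>_def)
      also have "\<dots> = (exp (- A * \<tau>) * (A * \<tau>)) * (M / A)" using \<open>A > 0\<close> by simp
      also have "\<dots> \<le> 1 * (M / A)"
      proof (rule mult_right_mono)
        \<comment> \<open>A bounded field lets the integral grow at most linearly, and the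
          exponential weight absorbs that.\<close>
        have "A * \<tau> \<le> exp (A * \<tau>)" using exp_ge_add_one_self[of "A * \<tau>"] by linarith
        then show "exp (- A * \<tau>) * (A * \<tau>) \<le> 1" by (simp add: exp_minus field_simps)
        show "0 \<le> M / A" using \<open>A > 0\<close> \<open>M \<ge> 0\<close> by simp
      qed
      finally show "norm z \<le> 1 * (M / A)" .
    qed
  qed
  define \<Phi> where "\<Phi> w = Bcontfun (P w)" for w
  have \<Phi>: "apply_bcontfun (\<Phi> w) = P w" for w
    unfolding \<Phi>_def by (rule Bcontfun_inverse[OF Pb])
  have "dist (\<Phi> w) (\<Phi> w') \<le> (1/2) * dist w w'" for w w'
  proof (rule dist_bound)
    fix t :: real
    define \<tau> where "\<tau> = max 0 t"
    have "\<tau> \<ge> 0" by (simp add: \<tau>_def)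
    have "norm (integral {0..\<tau>} (\<lambda>s. F s (X w s) - F s (X w' s))) \<le>
      integral {0..\<tau>} (\<lambda>s. L * dist w w' * exp (A * s))"
    proof (rule integral_norm_bound_integral)
      fix s
      have "\<bar>F s (X w s) - F s (X w' s)\<bar> \<le> L * \<bar>X w s - X w' s\<bar>" by (rule lip)
      also have "\<bar>X w s - X w' s\<bar> = exp (A * s) * dist (apply_bcontfun w s) (apply_bcontfun w' s)"
        by (simp add: X_def dist_real_def abs_mult flip: right_diff_distrib)
      also have "L * \<dots> \<le> L * (exp (A * s) * dist w w')"
        using \<open>L > 0\<close> by (intro mult_left_mono dist_bounded) auto
      finally show "norm (F s (X w s) - F s (X w' s)) \<le> L * dist w w' * exp (A * s)"
        by (simp add: mult_ac)
    next
      show "(\<lambda>s. F s (X w s) - F s (X w' s)) integrable_on {0..\<tau>}"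
        by (intro integrable_diff intX)
    qed (auto intro!: integrable_continuous_real continuous_intros)
    also have "\<dots> = L * dist w w' * ((exp (A * \<tau>) - 1) / A)"
      using exp_has_integral[of A \<tau>] \<open>A > 0\<close> \<open>\<tau> \<ge> 0\<close> by (simp add: integral_unique)
    \<comment> \<open>Here the choice \<open>A = 2 * L\<close> gives the contraction factor L / A =
      1/2.\<close>
    also have "\<dots> \<le> dist w w' / 2 * exp (A * \<tau>)"
      using \<open>L > 0\<close> by (simp add: A_def field_simps)
    finally have "norm (integral {0..\<tau>} (\<lambda>s. F s (X w s) - F s (X w' s))) \<le> dist w w' / 2 * exp (A * \<tau>)" .
    then have "exp (- A * \<tau>) * norm (integral {0..\<tau>} (\<lambda>s. F s (X w s) - F s (X w' s))) \<le>
       exp (- A * \<tau>) * (dist w w' / 2 * exp (A * \<tau>))"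
      by (intro mult_left_mono) auto
    also have "\<dots> = 1/2 * dist w w'" by (simp add: exp_minus)
    also have "integral {0..\<tau>} (\<lambda>s. F s (X w s) - F s (X w' s)) =
      integral {0..\<tau>} (\<lambda>s. F s (X w s)) - integral {0..\<tau>} (\<lambda>s. F s (X w' s))"
      by (intro integral_diff intX)
    finally show "dist (apply_bcontfun (\<Phi> w) t) (apply_bcontfun (\<Phi> w') t) \<le> 1/2 * dist w w'"
      by (simp add: \<Phi> P_def dist_real_def abs_mult flip: \<tau>_def right_diff_distrib)
  qed
  then obtain w where w: "\<Phi> w = w"
    using banach_fix_type[of "1/2" \<Phi>] by auto
  have "X w t = x0 + integral {0..t} (\<lambda>s. F s (X w s))" if "t \<ge> 0" for t
  proof -
    have "apply_bcontfun w t = P w t" using \<Phi>[of w] w by simp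
    then show ?thesis using that by (simp add: X_def P_def exp_minus max_absorb2)
  qed
  then show ?thesis using contX by blast
qed

text \<open>At a maximum point \<tau> of \<open>exp (- 2 * L * s) * \<phi> s\<close> the integral
  inequality bounds \<phi> \<tau> by half of itself. So this maximum is 0, and \<phi> vanishes
  everywhere.\<close>

lemma gronwall_zero:
  fixes \<phi> :: "real \<Rightarrow> real"
  assumes cont: "continuous_on {0..T} \<phi>" and "L > 0" and nonneg: "\<And>t. t \<in> {0..T} \<Longrightarrow> 0 \<le> \<phi> t"
    and le: "\<And>t. t \<in> {0..T} \<Longrightarrow> \<phi> t \<le> L * integral {0..t} \<phi>" and t: "t \<in> {0..T}"
  shows "\<phi> t = 0"
proof -
  define \<psi> where "\<psi> s = exp (- (2 * L) * s) * \<phi> s" for s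
  have "continuous_on {0..T} \<psi>" unfolding \<psi>_def by (intro continuous_intros cont)
  then obtain \<tau> where \<tau>: "\<tau> \<in> {0..T}" "\<And>s. s \<in> {0..T} \<Longrightarrow> \<psi> s \<le> \<psi> \<tau>"
    using continuous_attains_sup[of "{0..T}" \<psi>] t by auto
  have "\<phi> \<tau> \<le> L * integral {0..\<tau>} \<phi>" using le \<tau> by blast
  also have "integral {0..\<tau>} \<phi> \<le> integral {0..\<tau>} (\<lambda>s. \<psi> \<tau> * exp (2 * L * s))"
  proof (rule integral_le)
    show "\<phi> integrable_on {0..\<tau>}"
      using \<tau> by (intro integrable_continuous_real continuous_on_subset[OF cont]) auto
    fix s assume "s \<in> {0..\<tau>}"
    then have "\<psi> s \<le> \<psi> \<tau>" using \<tau> by auto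
    then show "\<phi> s \<le> \<psi> \<tau> * exp (2 * L * s)" by (simp add: \<psi>_def exp_minus field_simps)
  qed (auto intro!: integrable_continuous_real continuous_intros)
  also have "\<dots> = \<psi> \<tau> * ((exp (2 * L * \<tau>) - 1) / (2 * L))"
    using exp_has_integral[of "2 * L" \<tau>] \<tau> \<open>L > 0\<close> by (simp add: integral_unique)
  finally have "\<phi> \<tau> \<le> \<psi> \<tau> * ((exp (2 * L * \<tau>) - 1) / 2)" using \<open>L > 0\<close> by simp
  also have "\<dots> \<le> \<psi> \<tau> * (exp (2 * L * \<tau>) / 2)"
    using nonneg[OF \<tau>(1)] by (intro mult_left_mono) (auto simp: \<psi>_def)
  also have "\<dots> = \<phi> \<tau> / 2" by (simp add: \<psi>_def exp_minus)
  finally have "\<phi> \<tau> = 0" using nonneg[OF \<tau>(1)] by simp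
  then have "\<psi> t \<le> 0" using \<tau>(2)[OF t] by (simp add: \<psi>_def)
  then show ?thesis using nonneg[OF t] by (simp add: \<psi>_def mult_le_0_iff)
qed

text \<open>This is what makes uniqueness apply to every competitor: an arbitrary solution satisfies
  the integral equation without a prior bound on the field along it.\<close>

lemma caratheodory_solution_has_integral:
  assumes sol: "caratheodory_solution F D I y" and "{a..b} \<subseteq> I" "a \<le> b"
  shows "((\<lambda>s. F s (y s)) has_integral (y b - y a)) {a..b}"
proof (rule fundamental_theorem_of_calculus_absolutely_continuous)
  show "absolutely_continuous_on a b y"
    using sol assms(2) by (simp add: caratheodory_solution_def)
  let ?N = "{t. \<not> (t \<in> I \<longrightarrow> (y has_real_derivative F t (y t)) (at t within I))}"
  show "negligible ?N"
    using sol unfolding AE_lebesgue_negligible[symmetric] by (simp add: caratheodory_solution_def)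
  show "(y has_real_derivative F t (y t)) (at t within {a..b})" if "t \<in> {a..b} - ?N" for t
    using that assms(2) by (auto intro: has_field_derivative_subset)
qed (rule assms)

lemma caratheodory_solution_of_integral_equation:
  assumes "\<And>t. t \<ge> 0 \<Longrightarrow> x t \<in> D"
    and eq: "\<And>t. t \<ge> 0 \<Longrightarrow> x t = x0 + integral {0..t} (\<lambda>s. F s (x s))"
    and int: "\<And>T. (\<lambda>s. F s (x s)) integrable_on {0..T}"
    and M: "\<And>s. s \<ge> 0 \<Longrightarrow> \<bar>F s (x s)\<bar> \<le> M"
  shows "caratheodory_solution F D {0..} x"
  unfolding caratheodory_solution_def
proof (intro conjI ballI allI impI)
  fix a b :: real assume ab: "{a..b} \<subseteq> {0..}"
  show "absolutely_continuous_on a b x"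
  proof (rule absolutely_continuous_on_lipschitz)
    show "M \<ge> 0" using M[of 0] by linarith
    fix s t assume st: "s \<in> {a..b}" "t \<in> {a..b}"
    then have "s \<ge> 0" "t \<ge> 0" using ab by auto
    then have "\<bar>integral {0..s} (\<lambda>s. F s (x s)) - integral {0..t} (\<lambda>s. F s (x s))\<bar> \<le> M * \<bar>s - t\<bar>"
      by (intro indefinite_integral_lipschitz[OF int[of "max s t"]] M) auto
    then show "\<bar>x s - x t\<bar> \<le> M * \<bar>s - t\<bar>" using eq \<open>s \<ge> 0\<close> \<open>t \<ge> 0\<close> by simp
  qed
next
  let ?h = "\<lambda>s. F s (x s)"
  \<comment> \<open>The half-line is exhausted by the intervals from 0 to n. At a point t < n the
    derivative within such an interval is the derivative within the half-line, so countably many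
    null sets suffice.\<close>
  let ?N = "\<lambda>n::nat. {t \<in> {0..real n}.
    \<not> ((\<lambda>s. integral {0..s} ?h) has_real_derivative ?h t) (at t within {0..real n})}"
  have "negligible (\<Union>n. ?N n)"
    by (rule negligible_Union_nat) (rule indefinite_integral_has_derivative_ae[OF int])
  moreover have "{t. \<not> (t \<in> {0..} \<longrightarrow> (x has_real_derivative F t (x t)) (at t within {0..}))} \<subseteq> (\<Union>n. ?N n)"
  proof (rule subsetI, rule ccontr)
    fix t assume t: "t \<in> {t. \<not> (t \<in> {0..} \<longrightarrow> (x has_real_derivative F t (x t)) (at t within {0..}))}"
      and "t \<notin> (\<Union>n. ?N n)"
    then have "t \<ge> 0" by auto
    obtain n :: nat where n: "t < real n" using reals_Archimedean2 by blast
    have "t \<notin> ?N n" using \<open>t \<notin> (\<Union>n. ?N n)\<close> by blast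
    then have "((\<lambda>s. x0 + integral {0..s} ?h) has_real_derivative 0 + ?h t) (at t within {0..real n})"
      using \<open>t \<ge> 0\<close> n by (intro DERIV_add DERIV_const) auto
    then have "(x has_real_derivative ?h t) (at t within {0..real n})"
      by (rule has_field_derivative_transform_within[where d = 1, THEN DERIV_cong])
         (use \<open>t \<ge> 0\<close> n eq in auto)
    moreover have "at t within {0..real n} = at t within {0..}"
      by (rule at_within_nhd[of _ "{..<real n}"]) (use n in auto)
    ultimately show False using t by simp
  qed
  ultimately have "negligible {t. \<not> (t \<in> {0..} \<longrightarrow> (x has_real_derivative F t (x t)) (at t within {0..}))}"
    by (rule negligible_subset)
  then show "AE t in lebesgue. t \<in> {0..} \<longrightarrow> (x has_real_derivative F t (x t)) (at t within {0..})"
    unfolding AE_lebesgue_negligible .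
qed (use assms(1) in auto)

text \<open>As \<open>h\<close> need not be continuous, x has derivative \<open>h\<close> only
  almost everywhere. The bounds on \<open>h\<close> and \<open>f'\<close> make the composition
  Lipschitz, hence absolutely continuous, and the chain rule off a null set is then enough.\<close>

lemma integral_chain_rule:
  fixes x h f f' :: "real \<Rightarrow> real"
  assumes "0 \<le> T" and int: "h integrable_on {0..T}" and M: "\<And>s. s \<in> {0..T} \<Longrightarrow> \<bar>h s\<bar> \<le> M"
    and eq: "\<And>t. t \<in> {0..T} \<Longrightarrow> x t = x0 + integral {0..t} h"
    and K: "convex K" "\<And>t. t \<in> {0..T} \<Longrightarrow> x t \<in> K"
    and der: "\<And>z. z \<in> K \<Longrightarrow> (f has_real_derivative f' z) (at z)"
    and N: "\<And>z. z \<in> K \<Longrightarrow> \<bar>f' z\<bar> \<le> N"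
  shows "((\<lambda>s. f' (x s) * h s) has_integral (f (x T) - f x0)) {0..T}"
proof -
  let ?N = "{t \<in> {0..T}. \<not> ((\<lambda>s. integral {0..s} h) has_real_derivative h t) (at t within {0..T})}"
  have x0: "x 0 = x0" using eq[of 0] \<open>0 \<le> T\<close> by simp
  have "N \<ge> 0" "M \<ge> 0" using N[OF K(2)[of 0]] M[of 0] \<open>0 \<le> T\<close> by auto
  have "((\<lambda>s. f' (x s) * h s) has_integral (f (x T) - f (x 0))) {0..T}"
  proof (rule fundamental_theorem_of_calculus_absolutely_continuous[where f = "\<lambda>s. f (x s)"])
    show "absolutely_continuous_on 0 T (\<lambda>s. f (x s))"
    proof (rule absolutely_continuous_on_lipschitz)
      show "0 \<le> N * M" using \<open>N \<ge> 0\<close> \<open>M \<ge> 0\<close> by simp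
      fix s t assume st: "s \<in> {0..T}" "t \<in> {0..T}"
      have "norm (f (x s) - f (x t)) \<le> N * norm (x s - x t)"
        by (rule field_differentiable_bound[OF K(1), of f f' N])
           (use st K der N in \<open>auto intro: has_field_derivative_at_within\<close>)
      also have "\<bar>x s - x t\<bar> \<le> M * \<bar>s - t\<bar>"
        using indefinite_integral_lipschitz[OF int M st] eq st by simp
      then have "N * norm (x s - x t) \<le> N * (M * \<bar>s - t\<bar>)"
        using \<open>N \<ge> 0\<close> by (intro mult_left_mono) auto
      finally show "\<bar>f (x s) - f (x t)\<bar> \<le> N * M * \<bar>s - t\<bar>" by (simp add: mult.assoc)
    qed
    show "negligible ?N" by (rule indefinite_integral_has_derivative_ae[OF int])
    fix t assume t: "t \<in> {0..T} - ?N"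
    then have "((\<lambda>s. x0 + integral {0..s} h) has_real_derivative 0 + h t) (at t within {0..T})"
      by (intro DERIV_add DERIV_const) auto
    then have "(x has_real_derivative h t) (at t within {0..T})"
      by (rule has_field_derivative_transform_within[where d = 1, THEN DERIV_cong])
         (use t eq in auto)
    from DERIV_chain2[OF der this] show "((\<lambda>s. f (x s)) has_real_derivative f' (x t) * h t) (at t within {0..T})"
      using t K by auto
  qed (rule \<open>0 \<le> T\<close>)
  then show ?thesis by (simp add: x0)
qed

section \<open>Differentiability classes\<close>

lemma Ck_on_0: "Ck_on 0 D f \<longleftrightarrow> continuous_on D f"
  by (simp add: Ck_on_def)

text \<open>This peels off the innermost derivative, so that inductions on the order can generalize
  over the function and continue with its derivative.\<close>

lemma Ck_on_Suc:
  "Ck_on (Suc k) D f \<longleftrightarrow> (\<forall>x\<in>D. f field_differentiable (at x)) \<and> Ck_on k D (deriv f)"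
proof -
  have "(deriv ^^ Suc j) f = (deriv ^^ j) (deriv f)" for j
    by (simp add: funpow_Suc_right del: funpow.simps)
  then show ?thesis
    unfolding Ck_on_def All_less_Suc2 by (auto simp del: funpow.simps simp: funpow_0)
qed

lemma Ck_on_continuous_on: "Ck_on k D f \<Longrightarrow> continuous_on D f"
  by (cases k) (auto simp: Ck_on_0 Ck_on_Suc
      intro!: continuous_at_imp_continuous_on field_differentiable_imp_continuous_at)

lemma Ck_on_mono_Suc: "Ck_on (Suc k) D f \<Longrightarrow> Ck_on k D f"
  by (auto simp: Ck_on_def intro!: continuous_at_imp_continuous_on field_differentiable_imp_continuous_at)

lemma Ck_on_mono: "Ck_on k D f \<Longrightarrow> j \<le> k \<Longrightarrow> Ck_on j D f"
  by (induction k rule: nat_induct) (auto simp: le_Suc_eq dest: Ck_on_mono_Suc)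

lemma deriv_cong_on_open:
  assumes "open D" "x \<in> D" "\<And>x. x \<in> D \<Longrightarrow> f x = g x"
  shows "deriv f x = deriv g x"
proof (rule deriv_cong_ev[OF _ refl])
  show "\<forall>\<^sub>F x in nhds x. f x = g x"
    using assms by (auto simp: eventually_nhds)
qed

text \<open>The sum and product rules, and \<open>lie_deriv_eq\<close>, identify
  \<open>deriv\<close> or \<open>lie_deriv\<close> with a formula only at points of
  \<open>D\<close>. This lemma carries regularity across such identities.\<close>

lemma Ck_on_cong:
  assumes "open D"
  shows "Ck_on k D f \<Longrightarrow> (\<And>x. x \<in> D \<Longrightarrow> f x = g x) \<Longrightarrow> Ck_on k D g"
proof (induction k arbitrary: f g)
  case 0
  then show ?case by (simp add: Ck_on_0 cong: continuous_on_cong)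
next
  case (Suc k)
  have "g field_differentiable (at x)" if xD: "x \<in> D" for x
  proof -
    obtain d where "(f has_field_derivative d) (at x)"
      using Suc.prems xD by (auto simp: Ck_on_Suc field_differentiable_def)
    then have "(g has_field_derivative d) (at x)"
      by (rule has_field_derivative_transform_within_open[OF _ \<open>open D\<close> xD Suc.prems(2)])
    then show ?thesis by (auto simp: field_differentiable_def)
  qed
  moreover have "Ck_on k D (deriv g)"
  proof (rule Suc.IH)
    show "Ck_on k D (deriv f)" using Suc.prems(1) by (simp add: Ck_on_Suc)
    show "deriv f x = deriv g x" if "x \<in> D" for x
      by (rule deriv_cong_on_open[OF \<open>open D\<close> that Suc.prems(2)])
  qed
  ultimately show ?case by (simp add: Ck_on_Suc)
qed

lemma Ck_on_const [simp]: "Ck_on k D (\<lambda>_. c)"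
  by (induction k arbitrary: c) (simp_all add: Ck_on_0 Ck_on_Suc)

lemma Ck_on_ident: "Ck_on k D (\<lambda>x. x)"
  by (cases k) (simp_all add: Ck_on_0 Ck_on_Suc)

lemma Ck_on_add:
  assumes "open D"
  shows "Ck_on k D f \<Longrightarrow> Ck_on k D g \<Longrightarrow> Ck_on k D (\<lambda>x. f x + g x)"
proof (induction k arbitrary: f g)
  case 0
  then show ?case by (simp add: Ck_on_0 continuous_on_add)
next
  case (Suc k)
  have "Ck_on k D (deriv (\<lambda>x. f x + g x))"
    by (rule Ck_on_cong[OF \<open>open D\<close> Suc.IH[of "deriv f" "deriv g"]])
       (use Suc.prems in \<open>auto simp: Ck_on_Suc\<close>)
  then show ?case using Suc.prems by (auto simp: Ck_on_Suc intro: field_differentiable_add)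
qed

lemma Ck_on_mult:
  assumes "open D"
  shows "Ck_on k D f \<Longrightarrow> Ck_on k D g \<Longrightarrow> Ck_on k D (\<lambda>x. f x * g x)"
proof (induction k arbitrary: f g)
  case 0
  then show ?case by (simp add: Ck_on_0 continuous_on_mult)
next
  case (Suc k)
  have "Ck_on k D (\<lambda>x. f x * deriv g x + deriv f x * g x)"
    using Suc.prems Ck_on_mono_Suc
    by (intro Ck_on_add Suc.IH \<open>open D\<close>) (auto simp: Ck_on_Suc)
  then have "Ck_on k D (deriv (\<lambda>x. f x * g x))"
    by (rule Ck_on_cong[OF \<open>open D\<close>]) (use Suc.prems in \<open>auto simp: Ck_on_Suc\<close>)
  then show ?case using Suc.prems by (auto simp: Ck_on_Suc intro: field_differentiable_mult)
qed

lemma Ck_on_lie_deriv: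
  assumes "open D" "Ck_on (Suc k) D f" "Ck_on k D g"
  shows "Ck_on k D (lie_deriv g f)"
proof (rule Ck_on_cong[OF \<open>open D\<close>])
  show "Ck_on k D (\<lambda>x. deriv f x * g x)"
    using assms by (intro Ck_on_mult) (auto simp: Ck_on_Suc)
  show "deriv f x * g x = lie_deriv g f x" if "x \<in> D" for x
    using assms(2) that by (simp add: lie_deriv_eq Ck_on_Suc)
qed

section \<open>Remainder of the Chen--Fliess expansion\<close>

abbreviation fold_lie :: "(nat \<Rightarrow> real \<Rightarrow> real) \<Rightarrow> nat list \<Rightarrow> (real \<Rightarrow> real) \<Rightarrow> real \<Rightarrow> real" where
  "fold_lie G \<equiv> fold (\<lambda>j f. lie_deriv (G j) f)"

text \<open>Each letter costs one derivative of the function it acts on. The budget is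
  \<open>Suc m\<close> although the fields are only m times differentiable: the first letter already
  differentiates \<open>f\<close>, so at most m derivatives ever fall on a field. For the identity,
  words of m + 1 letters thus stay continuous.\<close>

lemma Ck_on_fold_lie:
  assumes "open D" and G: "\<And>k. k \<in> A \<Longrightarrow> Ck_on m D (G k)"
  shows "set ks \<subseteq> A \<Longrightarrow> Ck_on (n + length ks) D f \<Longrightarrow> n + length ks \<le> Suc m \<Longrightarrow>
    Ck_on n D (fold_lie G ks f)"
proof (induction ks arbitrary: f)
  case (Cons k ks)
  have "Ck_on (n + length ks) D (lie_deriv (G k) f)"
    using Cons.prems G Ck_on_mono[of m D "G k" "n + length ks"]
    by (intro Ck_on_lie_deriv \<open>open D\<close>) auto
  then show ?case using Cons by simp
qed simp

text \<open>The first field of a word is the Lie derivative of the identity along it, so the first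
  letter loses its special role.\<close>

lemma iterated_lie_eq_fold_lie:
  assumes "ks \<noteq> []"
  shows "iterated_lie G ks = fold_lie G ks (\<lambda>x. x)"
proof -
  have "lie_deriv (G k) (\<lambda>x. x) = G k" for k
    by (rule ext) (simp add: lie_deriv_eq)
  then show ?thesis using assms by (cases ks) auto
qed

lemma sum_lists_length_Suc:
  "(\<Sum>ks\<in>{ks. set ks \<subseteq> A \<and> length ks = Suc l}. F ks) =
    (\<Sum>k\<in>A. \<Sum>ks\<in>{ks. set ks \<subseteq> A \<and> length ks = l}. F (k # ks))"
proof -
  let ?L = "{ks. set ks \<subseteq> A \<and> length ks = l}"
  have "(\<Sum>ks\<in>{ks. set ks \<subseteq> A \<and> length ks = Suc l}. F ks) = (\<Sum>(xs, k)\<in>?L \<times> A. F (k # xs))"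
    unfolding lists_length_Suc_eq
    by (subst sum.reindex) (auto simp: inj_on_def intro!: sum.cong)
  also have "\<dots> = (\<Sum>xs\<in>?L. \<Sum>k\<in>A. F (k # xs))"
    by (rule sum.cartesian_product[symmetric])
  also have "\<dots> = (\<Sum>k\<in>A. \<Sum>xs\<in>?L. F (k # xs))"
    by (rule sum.swap)
  finally show ?thesis .
qed

text \<open>The definition uses the Lebesgue integral, the estimates the gauge integral. They agree
  on absolutely integrable functions, and a bounded measurable input times a continuous inner
  integral is one; continuity is therefore carried along the word.\<close>

lemma iterated_integral_props:
  assumes u: "\<And>k. k \<in> A \<Longrightarrow> u k \<in> borel_measurable lebesgue"
    and B: "\<And>k t. k \<in> A \<Longrightarrow> \<bar>u k t\<bar> \<le> B"
  shows iterated_integral_continuous: "set ks \<subseteq> A \<Longrightarrow> continuous_on {0..T} (iterated_integral u ks)"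
    and iterated_integral_has_integral: "set (k # ks) \<subseteq> A \<Longrightarrow>
      ((\<lambda>s. u k s * iterated_integral u ks s) has_integral iterated_integral u (k # ks) T) {0..T}"
proof -
  have step: "((\<lambda>s. u k s * iterated_integral u ks s) has_integral iterated_integral u (k # ks) T) {0..T}"
    if "k \<in> A" "continuous_on {0..T} (iterated_integral u ks)" for k ks T
  proof -
    note i = integrable_continuous_mult_bounded[OF that(2) u[OF that(1)] B[OF that(1)]]
    have "iterated_integral u (k # ks) T = integral {0..T} (\<lambda>s. u k s * iterated_integral u ks s)"
      using set_lebesgue_integral_eq_integral(2)[OF i(1)] by simp
    then show ?thesis using integrable_integral[OF i(2)] by (simp only:)
  qed
  show c: "continuous_on {0..T} (iterated_integral u ks)" if "set ks \<subseteq> A" for ks T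
    using that
  proof (induction ks arbitrary: T)
    case (Cons k ks)
    then have s: "((\<lambda>s. u k s * iterated_integral u ks s) has_integral iterated_integral u (k # ks) T) {0..T}" for T
      by (intro step) auto
    have "continuous_on {0..T} (\<lambda>t. integral {0..t} (\<lambda>s. u k s * iterated_integral u ks s))"
      by (rule indefinite_integral_continuous_1[OF has_integral_integrable[OF s]])
    then show ?case unfolding integral_unique[OF s] .
  qed simp
  show "((\<lambda>s. u k s * iterated_integral u ks s) has_integral iterated_integral u (k # ks) T) {0..T}"
    if "set (k # ks) \<subseteq> A"
    using that by (intro step c) auto
qed

text \<open>
  \<open>f\<close> is generalized so that the induction can peel off the first letter: the induction hypothesis is
  applied to \<open>lie_deriv (G k) f\<close> under the integral sign. The expansion of the state itself is
  the case \<open>f = (\<lambda>x. x)\<close>.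
\<close>
lemma fold_lie_remainder:
  fixes G u :: "nat \<Rightarrow> real \<Rightarrow> real"
  defines "L \<equiv> \<lambda>l. {ks :: nat list. set ks \<subseteq> {1, 2} \<and> length ks = l}"
  assumes "open D" "K \<subseteq> D" "convex K" "compact K"
    and G: "\<And>k. k \<in> {1, 2} \<Longrightarrow> Ck_on m D (G k)"
    and u: "\<And>k. k \<in> {1, 2} \<Longrightarrow> u k \<in> borel_measurable lebesgue"
    and B: "\<And>k t. k \<in> {1, 2} \<Longrightarrow> \<bar>u k t\<bar> \<le> B"
    and xc: "continuous_on {0..T} x" and xK: "\<And>t. t \<in> {0..T} \<Longrightarrow> x t \<in> K"
    and eq: "\<And>t. t \<in> {0..T} \<Longrightarrow> x t = x0 + integral {0..t} (\<lambda>s. \<Sum>k\<in>{1, 2}. u k s * G k (x s))"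
  shows "Ck_on n D f \<Longrightarrow> n \<le> Suc m \<Longrightarrow>
    (\<And>ks z. ks \<in> L n \<Longrightarrow> z \<in> K \<Longrightarrow> \<bar>fold_lie G ks f z\<bar> \<le> A) \<Longrightarrow> t \<in> {0..T} \<Longrightarrow>
    \<bar>f (x t) - (\<Sum>l<n. \<Sum>ks\<in>L l. fold_lie G ks f x0 * iterated_integral u ks t)\<bar> \<le> A * (2 * B * t) ^ n"
proof (induction n arbitrary: f t)
  case 0
  have "[] \<in> L 0" by (simp add: L_def)
  from 0(3)[OF this xK[OF 0(4)]] show ?case by simp
next
  case (Suc n)
  have "B \<ge> 0" using B[of 1 0] by simp
  have t: "0 \<le> t" "t \<le> T" using Suc.prems by auto
  have x0: "x 0 = x0" using eq[of 0] t by simp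
  have finL: "finite (L l)" for l by (simp add: L_def finite_lists_length_eq)
  have LSuc: "(\<Sum>ks\<in>L (Suc l). F ks) = (\<Sum>k\<in>{1,2}. \<Sum>ks\<in>L l. F (k # ks))" for l and F :: "nat list \<Rightarrow> real"
    unfolding L_def by (rule sum_lists_length_Suc)
  have L0: "L 0 = {[]}" by (auto simp: L_def)
  have A0: "A \<ge> 0"
  proof -
    have "replicate (Suc n) 1 \<in> L (Suc n)" by (auto simp: L_def)
    from Suc.prems(3)[OF this xK[OF Suc.prems(4)]] show ?thesis by linarith
  qed
  have fd: "(f has_real_derivative deriv f z) (at z)" if "z \<in> D" for z
    using Suc.prems(1) that by (auto simp: Ck_on_Suc DERIV_deriv_iff_field_differentiable)
  have lie: "lie_deriv (G k) f z = deriv f z * G k z" if "z \<in> D" for k z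
    using Suc.prems(1) that by (auto simp: Ck_on_Suc lie_deriv_eq)
  have CL: "Ck_on n D (lie_deriv (G k) f)" if "k \<in> {1, 2}" for k
    using Suc.prems(1,2) G[OF that] Ck_on_mono[of m D "G k" n]
    by (intro Ck_on_lie_deriv \<open>open D\<close>) auto
  have bdd: "\<exists>N. \<forall>z\<in>K. \<bar>p z\<bar> \<le> N" if "continuous_on D p" for p :: "real \<Rightarrow> real"
  proof -
    have "compact (p ` K)"
      using that \<open>K \<subseteq> D\<close> \<open>compact K\<close> by (meson compact_continuous_image continuous_on_subset)
    then show ?thesis by (meson compact_imp_bounded bounded_real imageI)
  qed
  have Gc: "continuous_on D (G k)" if "k \<in> {1, 2}" for k
    using G[OF that] by (rule Ck_on_continuous_on)
  have compx: "continuous_on {0..t} (\<lambda>s. p (x s))" if "continuous_on D p" for p :: "real \<Rightarrow> real"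
    by (rule continuous_on_compose2[OF that continuous_on_subset[OF xc]])
       (use t xK \<open>K \<subseteq> D\<close> in auto)
  define h where "h s = (\<Sum>k\<in>{1, 2}. u k s * G k (x s))" for s
  have h: "h integrable_on {0..t}"
    unfolding h_def by (intro integrable_sum integrable_continuous_mult_bounded[OF _ u B] compx Gc) auto
  obtain N1 where N1: "\<And>z. z \<in> K \<Longrightarrow> \<bar>G 1 z\<bar> \<le> N1" using bdd[OF Gc[of 1]] by auto
  obtain N2 where N2: "\<And>z. z \<in> K \<Longrightarrow> \<bar>G 2 z\<bar> \<le> N2" using bdd[OF Gc[of 2]] by auto
  have hM: "\<bar>h s\<bar> \<le> B * N1 + B * N2" if "s \<in> {0..t}" for s
  proof -
    have "x s \<in> K" using xK that t by auto
    have "\<bar>u 1 s * G 1 (x s)\<bar> \<le> B * N1" "\<bar>u 2 s * G 2 (x s)\<bar> \<le> B * N2"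
      unfolding abs_mult using B[of 1 s] B[of 2 s] N1[OF \<open>x s \<in> K\<close>] N2[OF \<open>x s \<in> K\<close>] \<open>B \<ge> 0\<close>
      by (auto intro!: mult_mono)
    then show ?thesis by (simp add: h_def)
  qed
  obtain N where N: "\<And>z. z \<in> K \<Longrightarrow> \<bar>deriv f z\<bar> \<le> N"
    using bdd[of "deriv f"] Suc.prems(1) by (auto simp: Ck_on_Suc dest: Ck_on_continuous_on)
  have "((\<lambda>s. deriv f (x s) * h s) has_integral (f (x t) - f x0)) {0..t}"
    by (rule integral_chain_rule[OF t(1) h hM _ \<open>convex K\<close> _ fd N])
       (use eq xK t \<open>K \<subseteq> D\<close> in \<open>auto simp: h_def\<close>)
  moreover have "deriv f (x s) * h s = (\<Sum>k\<in>{1,2}. u k s * lie_deriv (G k) f (x s))" if "s \<in> {0..t}" for s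
  proof -
    have "x s \<in> D" using that t xK \<open>K \<subseteq> D\<close> by auto
    then show ?thesis by (simp add: h_def lie algebra_simps)
  qed
  ultimately have i1: "((\<lambda>s. \<Sum>k\<in>{1,2}. u k s * lie_deriv (G k) f (x s)) has_integral (f (x t) - f x0)) {0..t}"
    by (rule has_integral_eq[rotated])
  \<comment> \<open>The expansion of order n of the Lie derivative of \<open>f\<close> along
    \<open>G k\<close>. Integrated against \<open>u k\<close> and summed over k, it becomes the
    expansion of \<open>f\<close> of order n + 1 without the constant term.\<close>
  define E where "E k s = (\<Sum>l<n. \<Sum>ks\<in>L l. fold_lie G ks (lie_deriv (G k) f) x0 * iterated_integral u ks s)" for k s
  have "((\<lambda>s. \<Sum>k\<in>{1,2}. \<Sum>l<n. \<Sum>ks\<in>L l. fold_lie G ks (lie_deriv (G k) f) x0 * (u k s * iterated_integral u ks s))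
    has_integral (\<Sum>k\<in>{1,2}. \<Sum>l<n. \<Sum>ks\<in>L l. fold_lie G ks (lie_deriv (G k) f) x0 * iterated_integral u (k # ks) t)) {0..t}"
    by (intro has_integral_sum has_integral_mult_right finL finite_lessThan
        iterated_integral_has_integral[where A = "{1, 2}", OF u B]) (auto simp: L_def)
  \<comment> \<open>The letter k is applied first among the Lie derivatives and belongs to the
    outermost integral, so on both sides it is put in front of the word.\<close>
  also have "(\<Sum>k\<in>{1,2}. \<Sum>l<n. \<Sum>ks\<in>L l. fold_lie G ks (lie_deriv (G k) f) x0 * iterated_integral u (k # ks) t) =
     (\<Sum>l<n. \<Sum>ks\<in>L (Suc l). fold_lie G ks f x0 * iterated_integral u ks t)"
    unfolding LSuc by (subst sum.swap) (simp del: iterated_integral.simps)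
  also have "\<dots> = (\<Sum>l<Suc n. \<Sum>ks\<in>L l. fold_lie G ks f x0 * iterated_integral u ks t) - f x0"
    unfolding sum.lessThan_Suc_shift by (simp add: L0)
  also have "(\<lambda>s. \<Sum>k\<in>{1,2}. \<Sum>l<n. \<Sum>ks\<in>L l. fold_lie G ks (lie_deriv (G k) f) x0 * (u k s * iterated_integral u ks s))
     = (\<lambda>s. \<Sum>k\<in>{1,2}. u k s * E k s)"
    by (simp add: E_def sum_distrib_left mult_ac)
  finally have i2: "((\<lambda>s. \<Sum>k\<in>{1,2}. u k s * E k s) has_integral
     ((\<Sum>l<Suc n. \<Sum>ks\<in>L l. fold_lie G ks f x0 * iterated_integral u ks t) - f x0)) {0..t}" .
  let ?r = "\<lambda>s. (\<Sum>k\<in>{1,2}. u k s * lie_deriv (G k) f (x s)) - (\<Sum>k\<in>{1,2}. u k s * E k s)"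
  have i3: "(?r has_integral (f (x t) - (\<Sum>l<Suc n. \<Sum>ks\<in>L l. fold_lie G ks f x0 * iterated_integral u ks t))) {0..t}"
    using has_integral_diff[OF i1 i2] by (simp only: diff_diff_eq2 diff_add_cancel)
  \<comment> \<open>Two letters, each contributing \<open>B\<close> times the bound of order n, give
    the factor \<open>2 * B\<close>. The power of the running time is replaced by its value at the
    end point, so no factorial is gained, and none is needed.\<close>
  have "\<bar>?r s\<bar> \<le> 2 * B * (A * (2 * B * t) ^ n)" if s: "s \<in> {0..t}" for s
  proof -
    have k: "\<bar>u k s * (lie_deriv (G k) f (x s) - E k s)\<bar> \<le> B * (A * (2 * B * t) ^ n)" if k: "k \<in> {1, 2}" for k
    proof -
      have "\<bar>lie_deriv (G k) f (x s) - E k s\<bar> \<le> A * (2 * B * s) ^ n"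
        unfolding E_def
      proof (rule Suc.IH[OF CL[OF k]])
        show "\<bar>fold_lie G ks (lie_deriv (G k) f) z\<bar> \<le> A" if "ks \<in> L n" "z \<in> K" for ks z
          using Suc.prems(3)[of "k # ks" z] that k by (auto simp: L_def)
      qed (use s t Suc.prems in auto)
      also have "\<dots> \<le> A * (2 * B * t) ^ n"
        using s A0 \<open>B \<ge> 0\<close> by (intro mult_left_mono power_mono) auto
      finally show ?thesis
        unfolding abs_mult using B[OF k] \<open>B \<ge> 0\<close> by (intro mult_mono) auto
    qed
    have "?r s = u 1 s * (lie_deriv (G 1) f (x s) - E 1 s) + u 2 s * (lie_deriv (G 2) f (x s) - E 2 s)"
      by (simp add: algebra_simps)
    then show ?thesis using k[of 1] k[of 2] by simp
  qed
  then have "\<bar>integral {0..t} ?r\<bar> \<le> 2 * B * (A * (2 * B * t) ^ n) * (t - 0)"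
    using i3 t by (intro abs_integral_le_const) auto
  then show ?case unfolding integral_unique[OF i3] by (simp add: algebra_simps)
qed

corollary chen_fliess_remainder:
  fixes G u :: "nat \<Rightarrow> real \<Rightarrow> real"
  assumes "open D" "K \<subseteq> D" "convex K" "compact K"
    and G: "\<And>k. k \<in> {1, 2} \<Longrightarrow> Ck_on m D (G k)"
    and u: "\<And>k. k \<in> {1, 2} \<Longrightarrow> u k \<in> borel_measurable lebesgue"
    and B: "\<And>k t. k \<in> {1, 2} \<Longrightarrow> \<bar>u k t\<bar> \<le> B"
    and xc: "continuous_on {0..T} x" and xK: "\<And>t. t \<in> {0..T} \<Longrightarrow> x t \<in> K"
    and eq: "\<And>t. t \<in> {0..T} \<Longrightarrow> x t = x0 + integral {0..t} (\<lambda>s. \<Sum>k\<in>{1, 2}. u k s * G k (x s))"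
    and A: "\<And>ks z. set ks \<subseteq> {1, 2} \<Longrightarrow> length ks = Suc m \<Longrightarrow> z \<in> K \<Longrightarrow> \<bar>iterated_lie G ks z\<bar> \<le> A"
    and t: "t \<in> {0..T}"
  shows "\<bar>x t - (x0 + chen_fliess m G u t x0)\<bar> \<le> A * (2 * B * t) ^ Suc m"
proof -
  let ?L = "\<lambda>l. {ks :: nat list. set ks \<subseteq> {1, 2} \<and> length ks = l}"
  have "\<bar>x t - (\<Sum>l<Suc m. \<Sum>ks\<in>?L l. fold_lie G ks (\<lambda>x. x) x0 * iterated_integral u ks t)\<bar>
    \<le> A * (2 * B * t) ^ Suc m"
  proof (rule fold_lie_remainder[OF assms(1-4) G u B xc xK eq _ _ _ t])
    show "\<bar>fold_lie G ks (\<lambda>x. x) z\<bar> \<le> A" if "ks \<in> ?L (Suc m)" "z \<in> K" for ks z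
    proof -
      have "ks \<noteq> []" using that by auto
      from iterated_lie_eq_fold_lie[OF this, of G] A[of ks z] that show ?thesis by simp
    qed
  qed (auto simp: Ck_on_ident)
  also have "(\<Sum>l<Suc m. \<Sum>ks\<in>?L l. fold_lie G ks (\<lambda>x. x) x0 * iterated_integral u ks t) =
     x0 + (\<Sum>l<m. \<Sum>ks\<in>?L (Suc l). fold_lie G ks (\<lambda>x. x) x0 * iterated_integral u ks t)"
  proof -
    have "?L 0 = {[]}" by auto
    then show ?thesis unfolding sum.lessThan_Suc_shift by simp
  qed
  also have "(\<Sum>l<m. \<Sum>ks\<in>?L (Suc l). fold_lie G ks (\<lambda>x. x) x0 * iterated_integral u ks t) = chen_fliess m G u t x0"
    unfolding chen_fliess_def sum.atLeast1_atMost_eq[folded One_nat_def]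
  proof (intro sum.cong refl)
    fix l ks assume "ks \<in> ?L (Suc l)"
    then have "ks \<noteq> []" by auto
    then show "fold_lie G ks (\<lambda>x. x) x0 * iterated_integral u ks t = iterated_lie G ks x0 * iterated_integral u ks t"
      by (simp add: iterated_lie_eq_fold_lie)
  qed
  finally show ?thesis .
qed

text \<open>There are finitely many words, and m + 1 is the greatest length for which
  differentiability of order m of the fields still guarantees a continuous iterated Lie
  derivative.\<close>

lemma iterated_lie_bounded:
  assumes "open D" "K \<subseteq> D" "compact K" and G: "\<And>k. k \<in> {1, 2} \<Longrightarrow> Ck_on m D (G k)"
  shows "\<exists>A\<ge>0. \<forall>ks z. set ks \<subseteq> {1, 2} \<longrightarrow> length ks = Suc m \<longrightarrow> z \<in> K \<longrightarrow> \<bar>iterated_lie G ks z\<bar> \<le> A"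
proof -
  let ?L = "{ks :: nat list. set ks \<subseteq> {1, 2} \<and> length ks = Suc m}"
  have "compact (\<Union>ks\<in>?L. iterated_lie G ks ` K)"
  proof (rule compact_UN)
    show "finite ?L" by (simp add: finite_lists_length_eq)
    fix ks assume ks: "ks \<in> ?L"
    then have "ks \<noteq> []" by auto
    have "Ck_on 0 D (fold_lie G ks (\<lambda>x. x))"
      using ks by (intro Ck_on_fold_lie[where A = "{1, 2}" and m = m, OF \<open>open D\<close> G]) (auto simp: Ck_on_ident)
    then have "continuous_on K (iterated_lie G ks)"
      unfolding iterated_lie_eq_fold_lie[OF \<open>ks \<noteq> []\<close>] Ck_on_0
      using \<open>K \<subseteq> D\<close> by (rule continuous_on_subset)
    then show "compact (iterated_lie G ks ` K)" using \<open>compact K\<close> by (rule compact_continuous_image)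
  qed
  then have "bounded (\<Union>ks\<in>?L. iterated_lie G ks ` K)" by (rule compact_imp_bounded)
  then obtain A where A: "\<forall>y\<in>(\<Union>ks\<in>?L. iterated_lie G ks ` K). \<bar>y\<bar> \<le> A"
    unfolding bounded_real by blast
  then have "\<bar>iterated_lie G ks z\<bar> \<le> max A 0" if "ks \<in> ?L" "z \<in> K" for ks z
    using that by fastforce
  then show ?thesis by (intro exI[of _ "max A 0"]) auto
qed

section \<open>Control systems with bounded inputs\<close>

definition control_field :: "(nat \<Rightarrow> real \<Rightarrow> real) \<Rightarrow> (nat \<Rightarrow> real \<Rightarrow> real) \<Rightarrow> real \<Rightarrow> real \<Rightarrow> real" where
  "control_field G u t z = (\<Sum>k\<in>{1, 2}. u k t * G k z)"

lemma control_field_integrable: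
  assumes "\<And>k. k \<in> {1, 2} \<Longrightarrow> u k \<in> borel_measurable lebesgue"
    and "\<And>k t. k \<in> {1, 2} \<Longrightarrow> \<bar>u k t\<bar> \<le> B"
    and "\<And>k. k \<in> {1, 2} \<Longrightarrow> continuous_on K (G k)"
    and "continuous_on {a..b} x" "\<And>t. t \<in> {a..b} \<Longrightarrow> x t \<in> K"
  shows "(\<lambda>s. control_field G u s (x s)) integrable_on {a..b}"
  unfolding control_field_def
proof (rule integrable_sum)
  fix k :: nat assume k: "k \<in> {1, 2}"
  have "continuous_on {a..b} (\<lambda>s. G k (x s))"
    by (rule continuous_on_compose2[OF assms(3)[OF k] assms(4)]) (use assms(5) in auto)
  then show "(\<lambda>s. u k s * G k (x s)) integrable_on {a..b}"
    using assms(1,2)[OF k] by (rule integrable_continuous_mult_bounded(2))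
qed simp

lemma control_field_bound:
  assumes "\<And>k. k \<in> {1, 2} \<Longrightarrow> \<bar>u k t\<bar> \<le> B" "\<And>k. k \<in> {1, 2} \<Longrightarrow> \<bar>G k z\<bar> \<le> N"
  shows "\<bar>control_field G u t z\<bar> \<le> 2 * B * N"
proof -
  have "\<bar>u k t * G k z\<bar> \<le> B * N" if "k \<in> {1, 2}" for k
  proof -
    have "0 \<le> B" using assms(1)[OF that] by linarith
    then show ?thesis unfolding abs_mult by (intro mult_mono assms that) auto
  qed
  from this[of 1] this[of 2] show ?thesis by (simp add: control_field_def)
qed

lemma control_field_lipschitz:
  assumes "\<And>k. k \<in> {1, 2} \<Longrightarrow> \<bar>u k t\<bar> \<le> B"
    and "\<And>k. k \<in> {1, 2} \<Longrightarrow> \<bar>G k z - G k z'\<bar> \<le> L * \<bar>z - z'\<bar>"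
  shows "\<bar>control_field G u t z - control_field G u t z'\<bar> \<le> 2 * B * L * \<bar>z - z'\<bar>"
proof -
  have "\<bar>u k t * (G k z - G k z')\<bar> \<le> B * (L * \<bar>z - z'\<bar>)" if "k \<in> {1, 2}" for k
  proof -
    have "0 \<le> B" using assms(1)[OF that] by linarith
    then show ?thesis unfolding abs_mult by (intro mult_mono assms that) auto
  qed
  from this[of 1] this[of 2] show ?thesis by (simp add: control_field_def algebra_simps)
qed

lemma Ck_on_lipschitz:
  assumes "Ck_on (Suc n) D f" "K \<subseteq> D" "convex K" "compact K"
  obtains L where "L > 0" "\<And>z z'. z \<in> K \<Longrightarrow> z' \<in> K \<Longrightarrow> \<bar>f z - f z'\<bar> \<le> L * \<bar>z - z'\<bar>"
proof -
  have "continuous_on K (deriv f)"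
    using assms(1,2) by (auto simp: Ck_on_Suc dest: Ck_on_continuous_on intro: continuous_on_subset)
  then obtain N where N: "\<And>z. z \<in> K \<Longrightarrow> \<bar>deriv f z\<bar> \<le> N"
    using compact_imp_bounded[OF compact_continuous_image[OF _ \<open>compact K\<close>], of "deriv f"]
    by (auto simp: bounded_real)
  show thesis
  proof (rule that[of "\<bar>N\<bar> + 1"])
    fix z z' assume z: "z \<in> K" "z' \<in> K"
    have "(f has_field_derivative deriv f z) (at z within K)" if "z \<in> K" for z
      by (rule has_field_derivative_at_within)
         (use assms(1,2) that in \<open>auto simp: Ck_on_Suc DERIV_deriv_iff_field_differentiable\<close>)
    then have "norm (f z - f z') \<le> (\<bar>N\<bar> + 1) * norm (z - z')"
      by (rule field_differentiable_bound[OF \<open>convex K\<close>]) (use N z in fastforce)+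
    then show "\<bar>f z - f z'\<bar> \<le> (\<bar>N\<bar> + 1) * \<bar>z - z'\<bar>" by simp
  qed auto
qed

lemma Ck_on_lipschitz_pair:
  assumes "\<And>k. k \<in> {1, 2} \<Longrightarrow> Ck_on (Suc n) D (G k)" "K \<subseteq> D" "convex K" "compact K"
  obtains L where "L > 0"
    "\<And>k z z'. k \<in> {1, 2 :: nat} \<Longrightarrow> z \<in> K \<Longrightarrow> z' \<in> K \<Longrightarrow> \<bar>G k z - G k z'\<bar> \<le> L * \<bar>z - z'\<bar>"
proof -
  obtain L1 where L1: "L1 > 0" "\<And>z z'. z \<in> K \<Longrightarrow> z' \<in> K \<Longrightarrow> \<bar>G 1 z - G 1 z'\<bar> \<le> L1 * \<bar>z - z'\<bar>"
    by (rule Ck_on_lipschitz[OF assms(1)[of 1] assms(2-4)]) auto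
  obtain L2 where L2: "L2 > 0" "\<And>z z'. z \<in> K \<Longrightarrow> z' \<in> K \<Longrightarrow> \<bar>G 2 z - G 2 z'\<bar> \<le> L2 * \<bar>z - z'\<bar>"
    by (rule Ck_on_lipschitz[OF assms(1)[of 2] assms(2-4)]) auto
  have le: "L1 * d \<le> (L1 + L2) * d" "L2 * d \<le> (L1 + L2) * d" if "d \<ge> 0" for d
    using L1 L2 that by (auto intro: mult_right_mono)
  show thesis
  proof (rule that[of "L1 + L2"])
    fix k :: nat and z z' assume kz: "k \<in> {1, 2}" "z \<in> K" "z' \<in> K"
    from kz L1(2)[OF kz(2,3)] L2(2)[OF kz(2,3)] le[of "\<bar>z - z'\<bar>"]
    show "\<bar>G k z - G k z'\<bar> \<le> (L1 + L2) * \<bar>z - z'\<bar>" by auto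
  qed (use L1 L2 in simp)
qed

lemma continuous_bounded_pair:
  fixes G :: "nat \<Rightarrow> real \<Rightarrow> real"
  assumes "\<And>k. k \<in> {1, 2} \<Longrightarrow> continuous_on K (G k)" "compact K"
  obtains N where "N \<ge> 0" "\<And>k z. k \<in> {1, 2} \<Longrightarrow> z \<in> K \<Longrightarrow> \<bar>G k z\<bar> \<le> N"
proof -
  have "bounded (G 1 ` K \<union> G 2 ` K)"
    using assms by (intro compact_imp_bounded compact_Un compact_continuous_image) auto
  then obtain N where N: "\<forall>y\<in>G 1 ` K \<union> G 2 ` K. \<bar>y\<bar> \<le> N" unfolding bounded_real by blast
  show thesis
  proof (rule that[of "\<bar>N\<bar>"])
    show "\<bar>G k z\<bar> \<le> \<bar>N\<bar>" if "k \<in> {1, 2}" "z \<in> K" for k z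
    proof -
      have "G k z \<in> G 1 ` K \<union> G 2 ` K" using that by auto
      from bspec[OF N this] show ?thesis by linarith
    qed
  qed simp
qed

text \<open>Staying in the compact set \<open>K\<close> bounds the field along x, so the integral
  equation gives a Caratheodory solution. For uniqueness a competitor y is cut at a time t before
  the end of its interval, where its path is compact; both paths then lie in one compact convex
  subset of \<open>D\<close>, on which the fields are Lipschitz, and Gronwall applies.\<close>

lemma control_global_solution:
  assumes "open D" "is_interval D" and G: "\<And>k. k \<in> {1, 2} \<Longrightarrow> Ck_on (Suc n) D (G k)"
    and u: "\<And>k. k \<in> {1, 2} \<Longrightarrow> u k \<in> borel_measurable lebesgue"
    and B: "\<And>k t. k \<in> {1, 2} \<Longrightarrow> \<bar>u k t\<bar> \<le> B" and "B > 0"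
    and K: "K \<subseteq> D" "compact K" "\<And>t. t \<ge> 0 \<Longrightarrow> x t \<in> K"
    and xc: "continuous_on {0..} x"
    and eq: "\<And>t. t \<ge> 0 \<Longrightarrow> x t = x0 + integral {0..t} (\<lambda>s. control_field G u s (x s))"
  shows "global_solution (control_field G u) D x0 x"
  unfolding global_solution_def
proof (intro conjI allI impI ballI; (elim conjE)?)
  have Gc: "continuous_on D (G k)" if "k \<in> {1, 2}" for k
    using G[OF that] by (rule Ck_on_continuous_on)
  obtain N where "N \<ge> 0" and N: "\<And>k z. k \<in> {1, 2} \<Longrightarrow> z \<in> K \<Longrightarrow> \<bar>G k z\<bar> \<le> N"
    by (rule continuous_bounded_pair[OF continuous_on_subset[OF Gc K(1)] K(2)]) (assumption, rule that)
  have int: "(\<lambda>s. control_field G u s (x s)) integrable_on {0..T}" for T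
  proof -
    have xT: "continuous_on {0..T} x" by (rule continuous_on_subset[OF xc]) simp
    have xK: "x t \<in> K" if "t \<in> {0..T}" for t using K(3) that by auto
    from control_field_integrable[OF u B continuous_on_subset[OF Gc K(1)] xT xK]
    show ?thesis by simp
  qed
  show "x 0 = x0" using eq[of 0] by simp
  show "caratheodory_solution (control_field G u) D {0..} x"
  proof (rule caratheodory_solution_of_integral_equation[where ?x0.0 = x0])
    show "x t = x0 + integral {0..t} (\<lambda>s. control_field G u s (x s))" if "t \<ge> 0" for t
      by (rule eq[OF that])
    show "(\<lambda>s. control_field G u s (x s)) integrable_on {0..T}" for T
      by (rule int)
    show "\<bar>control_field G u s (x s)\<bar> \<le> 2 * B * N" if "s \<ge> 0" for s
      by (rule control_field_bound) (use B N K(3)[OF that] in blast)+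
  qed (use K in auto)
  fix T y t
  assume y: "caratheodory_solution (control_field G u) D {0..<T} y" "y 0 = x0" and t: "t \<in> {0..<T}"
  have yD: "y s \<in> D" if "s \<in> {0..t}" for s
    using y(1) t that by (auto simp: caratheodory_solution_def)
  have yint: "((\<lambda>s. control_field G u s (y s)) has_integral (y s - x0)) {0..s}" if "s \<in> {0..t}" for s
  proof -
    have "{0..s} \<subseteq> {0..<T}" "0 \<le> s" using t that by auto
    from caratheodory_solution_has_integral[OF y(1) this] show ?thesis by (simp add: y(2))
  qed
  have yc: "continuous_on {0..t} y"
  proof -
    have "continuous_on {0..t} (\<lambda>s. x0 + integral {0..s} (\<lambda>s. control_field G u s (y s)))"
      using yint[of t] t by (intro continuous_intros indefinite_integral_continuous_1) auto
    moreover have "x0 + integral {0..s} (\<lambda>s. control_field G u s (y s)) = y s" if "s \<in> {0..t}" for s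
      using integral_unique[OF yint[OF that]] by simp
    ultimately show ?thesis by (rule continuous_on_eq)
  qed
  \<comment> \<open>The hull makes the mean value estimate available between the two paths; it stays
    inside \<open>D\<close> because \<open>D\<close> is an interval.\<close>
  define K' where "K' = convex hull (K \<union> y ` {0..t})"
  have K': "compact K'" "convex K'" "K' \<subseteq> D"
  proof -
    show "compact K'" unfolding K'_def
      by (intro compact_convex_hull compact_Un K compact_continuous_image yc) simp
    show "convex K'" unfolding K'_def by (rule convex_convex_hull)
    show "K' \<subseteq> D" unfolding K'_def
      using K(1) yD \<open>is_interval D\<close> by (intro hull_minimal) (auto simp: is_interval_convex)
  qed
  have inK': "x s \<in> K'" "y s \<in> K'" if "s \<in> {0..t}" for s
    using that K(3) hull_subset[of "K \<union> y ` {0..t}" convex] by (auto simp: K'_def)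
  obtain L where L: "L > 0"
    "\<And>k z z'. k \<in> {1, 2} \<Longrightarrow> z \<in> K' \<Longrightarrow> z' \<in> K' \<Longrightarrow> \<bar>G k z - G k z'\<bar> \<le> L * \<bar>z - z'\<bar>"
    by (rule Ck_on_lipschitz_pair[OF G K'(3,2,1)]) (assumption, rule that)
  have dc: "continuous_on {0..t} (\<lambda>s. \<bar>x s - y s\<bar>)"
    by (intro continuous_intros yc continuous_on_subset[OF xc]) auto
  have "\<bar>x t - y t\<bar> = 0"
  proof (rule gronwall_zero[OF dc, of "2 * B * L"])
    fix s assume s: "s \<in> {0..t}"
    have "((\<lambda>r. control_field G u r (x r)) has_integral (x s - x0)) {0..s}"
      using eq[of s] s integrable_integral[OF int[of s]] by simp
    from has_integral_diff[OF this yint[OF s]]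
    have i: "((\<lambda>r. control_field G u r (x r) - control_field G u r (y r)) has_integral (x s - y s)) {0..s}"
      by simp
    have "norm (integral {0..s} (\<lambda>r. control_field G u r (x r) - control_field G u r (y r)))
       \<le> integral {0..s} (\<lambda>r. 2 * B * L * \<bar>x r - y r\<bar>)"
    proof (rule integral_norm_bound_integral)
      show "(\<lambda>r. control_field G u r (x r) - control_field G u r (y r)) integrable_on {0..s}"
        using i by blast
      show "(\<lambda>r. 2 * B * L * \<bar>x r - y r\<bar>) integrable_on {0..s}"
        by (intro integrable_continuous_real continuous_intros yc continuous_on_subset[OF xc]
            continuous_on_subset[OF yc]) (use s in auto)
      show "norm (control_field G u r (x r) - control_field G u r (y r)) \<le> 2 * B * L * \<bar>x r - y r\<bar>"
        if "r \<in> {0..s}" for r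
        unfolding real_norm_def
      proof (rule control_field_lipschitz)
        have "r \<in> {0..t}" using s that by auto
        then show "\<bar>G k (x r) - G k (y r)\<bar> \<le> L * \<bar>x r - y r\<bar>" if "k \<in> {1, 2}" for k
          using L(2)[OF that] inK' by blast
      qed (use B in blast)
    qed
    then show "\<bar>x s - y s\<bar> \<le> 2 * B * L * integral {0..s} (\<lambda>r. \<bar>x r - y r\<bar>)"
      using integral_unique[OF i] by simp
  qed (use t L(1) \<open>B > 0\<close> in auto)
  then show "y t = x t" by simp
qed

text \<open>The fields are controlled only on the interval from a to b. Since clamping is Lipschitz
  with constant 1 and has values in that interval, the clamped field is bounded and Lipschitz on the
  whole line, as the Picard argument requires.\<close>

lemma clamped_integral_equation_exists:
  fixes a b :: real
  defines "cl \<equiv> \<lambda>z. max a (min b z)"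
  assumes "a \<le> b"
    and u: "\<And>k. k \<in> {1, 2} \<Longrightarrow> u k \<in> borel_measurable lebesgue"
    and B: "\<And>k t. k \<in> {1, 2} \<Longrightarrow> \<bar>u k t\<bar> \<le> B" and "B > 0"
    and N: "\<And>k z. k \<in> {1, 2} \<Longrightarrow> z \<in> {a..b} \<Longrightarrow> \<bar>G k z\<bar> \<le> N"
    and L: "L > 0" "\<And>k z z'. k \<in> {1, 2} \<Longrightarrow> z \<in> {a..b} \<Longrightarrow> z' \<in> {a..b} \<Longrightarrow> \<bar>G k z - G k z'\<bar> \<le> L * \<bar>z - z'\<bar>"
  shows "\<exists>x. (\<forall>t\<ge>0. x t = x0 + integral {0..t} (\<lambda>s. control_field G u s (cl (x s)))) \<and>
    (\<forall>s\<ge>0. \<forall>t\<ge>0. \<bar>x s - x t\<bar> \<le> 2 * B * N * \<bar>s - t\<bar>) \<and>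
    (\<forall>T. (\<lambda>s. control_field G u s (cl (x s))) integrable_on {0..T})"
proof -
  have cl: "cl z \<in> {a..b}" for z using \<open>a \<le> b\<close> by (auto simp: cl_def)
  have Gc: "continuous_on {a..b} (G k)" if "k \<in> {1, 2}" for k
    by (rule continuous_on_lipschitz_real[OF L(2)[OF that]])
  have int: "(\<lambda>s. control_field G u s (cl (y s))) integrable_on {0..T}" if "continuous_on {0..T} y" for T y
  proof -
    have "continuous_on {0..T} (\<lambda>s. cl (y s))" unfolding cl_def by (intro continuous_intros that)
    from control_field_integrable[OF u B Gc this cl] show ?thesis by simp
  qed
  have bd: "\<bar>control_field G u s (cl z)\<bar> \<le> 2 * B * N" for s z
    by (rule control_field_bound; use B N cl in blast)
  have lip: "\<bar>control_field G u s (cl z) - control_field G u s (cl z')\<bar> \<le> 2 * B * L * \<bar>z - z'\<bar>" for s z z'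
  proof -
    have "\<bar>control_field G u s (cl z) - control_field G u s (cl z')\<bar> \<le> 2 * B * L * \<bar>cl z - cl z'\<bar>"
      by (rule control_field_lipschitz; use B L(2) cl in blast)
    also have "\<dots> \<le> 2 * B * L * \<bar>z - z'\<bar>"
      using \<open>B > 0\<close> L(1) by (intro mult_left_mono) (auto simp: cl_def)
    finally show ?thesis .
  qed
  have "2 * B * L > 0" using \<open>B > 0\<close> L(1) by simp
  from integral_equation_exists[of "\<lambda>s z. control_field G u s (cl z)", OF int bd lip this]
  obtain x where xc: "continuous_on UNIV x"
    and x: "\<And>t. t \<ge> 0 \<Longrightarrow> x t = x0 + integral {0..t} (\<lambda>s. control_field G u s (cl (x s)))"
    by blast
  have i: "(\<lambda>s. control_field G u s (cl (x s))) integrable_on {0..T}" for T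
    by (rule int) (rule continuous_on_subset[OF xc], simp)
  have "\<bar>x s - x t\<bar> \<le> 2 * B * N * \<bar>s - t\<bar>" if "s \<ge> 0" "t \<ge> 0" for s t
    using indefinite_integral_lipschitz[OF i[of "max s t"] bd, of s t] x[OF that(1)] x[OF that(2)] that
    by simp
  then show ?thesis using x i by blast
qed

section \<open>Decay of the sampled state\<close>

text \<open>Restarting at a multiple of the period leaves the inputs unchanged, so every period is
  governed by the same equation with a new initial value. The path \<open>y\<close> inside the field
  is kept apart from x because it will be the clamped path.\<close>

lemma control_integral_shift:
  assumes eq: "\<And>t. t \<ge> 0 \<Longrightarrow> x t = x0 + integral {0..t} (\<lambda>s. control_field G u s (y s))"
    and int: "\<And>T. (\<lambda>s. control_field G u s (y s)) integrable_on {0..T}"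
    and per: "\<And>k t. k \<in> {1, 2} \<Longrightarrow> u k (t + p) = u k t" and "p \<ge> 0" "t \<ge> 0"
  shows "x (t + p) = x p + integral {0..t} (\<lambda>s. control_field G u s (y (s + p)))"
proof -
  let ?h = "\<lambda>s. control_field G u s (y s)"
  have "integral {0..p} ?h + integral {p..t + p} ?h = integral {0..t + p} ?h"
    by (rule Henstock_Kurzweil_Integration.integral_combine) (use assms in auto)
  moreover have "integral {p..t + p} ?h = integral {0..t} (\<lambda>s. ?h (s + p))"
    using integral_shift_real_ivl[of p p "t + p" ?h] by simp
  moreover have "control_field G u (s + p) z = control_field G u s z" for s z
    using per[of 1 s] per[of 2 s] by (simp add: control_field_def)
  ultimately show ?thesis using eq[of p] eq[of "t + p"] \<open>p \<ge> 0\<close> \<open>t \<ge> 0\<close> by simp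
qed

text \<open>The condition \<open>h * \<beta>2 \<le> 1\<close> rules out overshooting: for e > 0 the
  new error e - h P is still nonnegative, while the first assumption gives P \<ge> \<beta>1 e.
  Negative e follow by reflection.\<close>

lemma gradient_step_contraction:
  fixes e P :: real
  assumes "P * e \<ge> \<beta>1 * \<bar>e\<bar>\<^sup>2" "\<bar>P\<bar> \<le> \<beta>2 * \<bar>e\<bar>" "h \<ge> 0" "h * \<beta>2 \<le> 1"
  shows "\<bar>e - h * P\<bar> \<le> (1 - h * \<beta>1) * \<bar>e\<bar>"
proof -
  have key: "\<bar>e - h * P\<bar> \<le> (1 - h * \<beta>1) * e" if e: "e > 0" and 1: "P * e \<ge> \<beta>1 * e\<^sup>2" and 2: "\<bar>P\<bar> \<le> \<beta>2 * e" for e P :: real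
  proof -
    have "\<beta>1 * e \<le> P" using e 1 by (simp add: power2_eq_square)
    then have "h * (\<beta>1 * e) \<le> h * P" using \<open>h \<ge> 0\<close> by (intro mult_left_mono) auto
    moreover have "h * P \<le> h * (\<beta>2 * e)" using 2 \<open>h \<ge> 0\<close> by (intro mult_left_mono) auto
    moreover have "h * \<beta>2 * e \<le> 1 * e" using \<open>h * \<beta>2 \<le> 1\<close> e by (intro mult_right_mono) auto
    ultimately show ?thesis by (simp add: algebra_simps)
  qed
  consider "e > 0" | "e = 0" | "e < 0" by linarith
  then show ?thesis
  proof cases
    case 1
    then show ?thesis using key[of e P] assms by simp
  next
    case 2
    then show ?thesis using assms by simp
  next
    case 3
    then have "\<bar>- e - h * (- P)\<bar> \<le> (1 - h * \<beta>1) * (- e)"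
      using assms by (intro key) auto
    moreover have "\<bar>- e - h * (- P)\<bar> = \<bar>e - h * P\<bar>" using abs_minus_cancel[of "e - h * P"] by simp
    ultimately show ?thesis using 3 by simp
  qed
qed

lemma dither_add_period:
  assumes "\<And>t. v k (t + 1) = v k t" "\<epsilon> > 0"
  shows "dither m v \<epsilon> k (t + real n * \<epsilon>) = dither m v \<epsilon> k t"
proof (induction n)
  case (Suc n)
  have "dither m v \<epsilon> k (t + real (Suc n) * \<epsilon>) = dither m v \<epsilon> k (t + real n * \<epsilon> + \<epsilon>)"
    by (simp add: algebra_simps)
  also have "\<dots> = dither m v \<epsilon> k (t + real n * \<epsilon>)"
    using assms by (simp add: dither_def add_divide_distrib)
  finally show ?case using Suc by simp
qed simp

lemma dither_measurable:
  assumes "v k \<in> borel_measurable lebesgue"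
  shows "dither m v \<epsilon> k \<in> borel_measurable lebesgue"
proof -
  have "(\<lambda>t. v k ((1 / \<epsilon>) *\<^sub>R t)) \<in> borel_measurable lebesgue"
    by (rule measurable_compose[OF lebesgue_measurable_scaling assms])
  then show ?thesis unfolding dither_def by simp
qed

text \<open>Provides the margin r that a trajectory may use between two sampling times.\<close>

lemma is_interval_cball_enlarge:
  fixes xs :: real
  assumes "open D" "is_interval D" "\<delta> > 0" "closure (ball xs \<delta>) \<subseteq> D"
  obtains r where "r > 0" "{xs - (\<delta> + r)..xs + (\<delta> + r)} \<subseteq> D"
proof -
  have "xs + \<delta> \<in> closure (ball xs \<delta>)" "xs - \<delta> \<in> closure (ball xs \<delta>)"
    using assms(3) by (simp_all add: dist_real_def)
  then have "xs + \<delta> \<in> D" "xs - \<delta> \<in> D" using assms(4) by blast+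
  then obtain e1 e2 where e: "e1 > 0" "ball (xs + \<delta>) e1 \<subseteq> D" "e2 > 0" "ball (xs - \<delta>) e2 \<subseteq> D"
    using \<open>open D\<close> by (meson openE)
  define r where "r = min e1 e2 / 2"
  have r: "r > 0" "r < e1" "r < e2" using e by (auto simp: r_def)
  have "xs + (\<delta> + r) \<in> ball (xs + \<delta>) e1" "xs - (\<delta> + r) \<in> ball (xs - \<delta>) e2"
    using r by (simp_all add: dist_real_def)
  then have "xs + (\<delta> + r) \<in> D" "xs - (\<delta> + r) \<in> D" using e by blast+
  then have "z \<in> D" if "z \<in> {xs - (\<delta> + r)..xs + (\<delta> + r)}" for z
    using mem_is_interval_1_I[OF \<open>is_interval D\<close>, of "xs - (\<delta> + r)" "xs + (\<delta> + r)" z] that by simp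
  then have "{xs - (\<delta> + r)..xs + (\<delta> + r)} \<subseteq> D" by blast
  then show thesis using that r(1) by blast
qed

text \<open>The cost function enters only through \<open>p\<close>, which stands for its derivative
  of order m - 1; \<open>cf\<close> merges the excitation hypothesis with the value of the
  bracket.\<close>

proposition bounded_dither_stability:
  fixes G v :: "nat \<Rightarrow> real \<Rightarrow> real" and p :: "real \<Rightarrow> real"
  assumes "open D" "is_interval D" "m \<ge> 1"
    and G: "\<And>k. k \<in> {1, 2} \<Longrightarrow> Ck_on m D (G k)"
    and v: "\<And>k. k \<in> {1, 2} \<Longrightarrow> v k \<in> borel_measurable lebesgue"
    and C: "\<And>k t. k \<in> {1, 2} \<Longrightarrow> \<bar>v k t\<bar> \<le> C" "C > 0"
    and per: "\<And>k t. k \<in> {1, 2} \<Longrightarrow> v k (t + 1) = v k t"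
    and "\<beta>1 > 0" "\<beta>2 > 0" "cm > 0"
    and p1: "\<And>x. x \<in> D \<Longrightarrow> p x * (x - xs) \<ge> \<beta>1 * \<bar>x - xs\<bar>\<^sup>2"
    and p2: "\<And>x. x \<in> D \<Longrightarrow> \<bar>p x\<bar> \<le> \<beta>2 * \<bar>x - xs\<bar>"
    and cf: "\<And>\<epsilon> x0. \<epsilon> > 0 \<Longrightarrow> x0 \<in> D \<Longrightarrow> chen_fliess m G (dither m v \<epsilon>) \<epsilon> x0 = - (\<epsilon> * cm * p x0)"
  shows "semiglobally_practically_exp_stable D xs (\<lambda>\<epsilon>. control_field G (dither m v \<epsilon>))"
  unfolding semiglobally_practically_exp_stable_def
proof (intro allI impI)
  fix \<delta> :: real assume "\<delta> > 0" and cl\<delta>: "closure (ball xs \<delta>) \<subseteq> D"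
  obtain r where r: "r > 0" "{xs - (\<delta> + r)..xs + (\<delta> + r)} \<subseteq> D"
    by (rule is_interval_cball_enlarge[OF assms(1,2) \<open>\<delta> > 0\<close> cl\<delta>])
  define a where "a = xs - (\<delta> + r)"
  define b where "b = xs + (\<delta> + r)"
  define clamp where "clamp z = max a (min b z)" for z
  have KD: "{a..b} \<subseteq> D" using r(2) by (simp add: a_def b_def)
  have inK: "z \<in> {a..b} \<longleftrightarrow> \<bar>z - xs\<bar> \<le> \<delta> + r" for z by (auto simp: a_def b_def)
  have "a \<le> b" using \<open>\<delta> > 0\<close> r(1) by (simp add: a_def b_def)
  have Suc_m: "m = Suc (m - 1)" using \<open>m \<ge> 1\<close> by simp
  have G': "Ck_on (Suc (m - 1)) D (G k)" if "k \<in> {1, 2}" for k using G[OF that] Suc_m by simp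
  have Gc: "continuous_on {a..b} (G k)" if "k \<in> {1, 2}" for k
    using Ck_on_continuous_on[OF G[OF that]] KD by (rule continuous_on_subset)
  obtain N where N: "N \<ge> 0" "\<And>k z. k \<in> {1, 2} \<Longrightarrow> z \<in> {a..b} \<Longrightarrow> \<bar>G k z\<bar> \<le> N"
    by (rule continuous_bounded_pair[OF Gc compact_Icc]) (assumption, rule that)
  obtain L where L: "L > 0" "\<And>k z z'. k \<in> {1, 2} \<Longrightarrow> z \<in> {a..b} \<Longrightarrow> z' \<in> {a..b} \<Longrightarrow> \<bar>G k z - G k z'\<bar> \<le> L * \<bar>z - z'\<bar>"
    by (rule Ck_on_lipschitz_pair[OF G' KD convex_real_interval(5) compact_Icc]) (assumption, rule that)
  have "\<exists>A\<ge>0. \<forall>ks z. set ks \<subseteq> {1, 2} \<longrightarrow> length ks = Suc m \<longrightarrow> z \<in> {a..b} \<longrightarrow> \<bar>iterated_lie G ks z\<bar> \<le> A"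
    by (rule iterated_lie_bounded[OF \<open>open D\<close> KD compact_Icc]) (rule G)
  then obtain A where A: "A \<ge> 0" and A': "\<forall>ks z. set ks \<subseteq> {1, 2} \<longrightarrow> length ks = Suc m \<longrightarrow> z \<in> {a..b} \<longrightarrow>
      \<bar>iterated_lie G ks z\<bar> \<le> A"
    by (elim exE conjE)
  define \<mu> where "\<mu> = cm * \<beta>1"
  define R where "R = A * (2 * C) ^ Suc m"
  define M where "M = 2 * C * N"
  have pos: "\<mu> > 0" "R \<ge> 0" "M \<ge> 0"
    using \<open>cm > 0\<close> \<open>\<beta>1 > 0\<close> A C(2) N(1) by (auto simp: \<mu>_def R_def M_def)
  show "\<exists>c>0. \<exists>\<kappa>>0. \<forall>\<rho>\<in>{0<..<\<delta>}. \<exists>\<epsilon>0>0. \<forall>\<epsilon>\<in>{0<..\<epsilon>0}. \<forall>x0\<in>ball xs \<delta>.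
          \<exists>x. global_solution (control_field G (dither m v \<epsilon>)) D x0 x \<and>
              (\<forall>t\<ge>0. \<bar>x t - xs\<bar> \<le> c * \<bar>x0 - xs\<bar> * exp (- \<kappa> * t) + \<rho>)"
  \<comment> \<open>The rate \<mu> is the contraction of the gradient step per unit time. The
    constant \<open>exp \<mu>\<close> pays for the unfinished period at the end, whose length is at
    most \<epsilon> \<le> 1.\<close>
  proof (rule exI[of _ "exp \<mu>"], rule conjI, simp, rule exI[of _ \<mu>], intro conjI ballI)
    fix \<rho> assume \<rho>: "\<rho> \<in> {0<..<\<delta>}"
    define W where "W = R / \<mu> + M + 1"
    \<comment> \<open>The three demands on \<eta>: the motion within a period stays below the margin
      r, the error of one period does not push a sample out of the ball of radius \<delta>, and the
      sampled residual plus the motion within a period stays below \<rho>. The added ones in the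
      denominators only keep them positive.\<close>
    define q where "q = min (r / (M + 1)) (min (\<mu> * \<delta> / (R + 1)) (\<rho> / W))"
    \<comment> \<open>In order: periods of length at most 1, no overshooting in the gradient step, a
      nonnegative contraction factor, and \<eta> \<le> q.\<close>
    define \<epsilon>0 where "\<epsilon>0 = min (min 1 (1 / (cm * \<beta>2))) (min (1 / \<mu>) (q ^ m))"
    have den: "M + 1 > 0" "R + 1 > 0" "R / \<mu> \<ge> 0" "W > 0"
      using pos by (auto simp: W_def intro: add_nonneg_pos)
    have "r / (M + 1) > 0" "\<mu> * \<delta> / (R + 1) > 0" "\<rho> / W > 0"
      using r(1) pos \<rho> \<open>\<delta> > 0\<close> den by (auto intro!: divide_pos_pos mult_pos_pos)
    then have "q > 0" unfolding q_def by simp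
    have "\<epsilon>0 > 0" using pos \<open>q > 0\<close> \<open>cm > 0\<close> \<open>\<beta>2 > 0\<close> by (simp add: \<epsilon>0_def)
    show "\<exists>\<epsilon>0>0. \<forall>\<epsilon>\<in>{0<..\<epsilon>0}. \<forall>x0\<in>ball xs \<delta>.
          \<exists>x. global_solution (control_field G (dither m v \<epsilon>)) D x0 x \<and>
              (\<forall>t\<ge>0. \<bar>x t - xs\<bar> \<le> exp \<mu> * \<bar>x0 - xs\<bar> * exp (- \<mu> * t) + \<rho>)"
    proof (rule exI[of _ \<epsilon>0], intro conjI ballI)
      fix \<epsilon> x0 assume \<epsilon>: "\<epsilon> \<in> {0<..\<epsilon>0}" and x0: "x0 \<in> ball xs \<delta>"
      have "\<epsilon> > 0" using \<epsilon> by simp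
      have \<epsilon>le: "\<epsilon> \<le> 1" "\<epsilon> \<le> 1 / (cm * \<beta>2)" "\<epsilon> \<le> 1 / \<mu>" "\<epsilon> \<le> q ^ m"
        using \<epsilon> by (auto simp: \<epsilon>0_def)
      have \<epsilon>2: "\<epsilon> * cm * \<beta>2 \<le> 1"
        using \<epsilon>le(2) \<open>cm > 0\<close> \<open>\<beta>2 > 0\<close> by (simp add: field_simps)
      have \<epsilon>3: "\<epsilon> * \<mu> \<le> 1" using \<epsilon>le(3) pos(1) by (simp add: field_simps)
      define \<eta> where "\<eta> = \<epsilon> powr (1 / real m)"
      have "\<eta> > 0" using \<open>\<epsilon> > 0\<close> by (simp add: \<eta>_def)
      have \<eta>m: "\<eta> ^ m = \<epsilon>"
        using \<open>\<epsilon> > 0\<close> \<open>m \<ge> 1\<close> by (simp add: \<eta>_def powr_powr flip: powr_realpow)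
      have \<eta>q: "\<eta> \<le> q"
      proof (rule ccontr)
        assume "\<not> \<eta> \<le> q"
        then have "q ^ m < \<eta> ^ m" using \<open>q > 0\<close> \<open>m \<ge> 1\<close> by (intro power_strict_mono) auto
        then show False using \<eta>m \<epsilon>le(4) by simp
      qed
      have le1: "M * \<eta> \<le> r"
      proof -
        have "M * \<eta> \<le> (M + 1) * (r / (M + 1))"
          using \<eta>q pos \<open>\<eta> > 0\<close> by (intro mult_mono) (auto simp: q_def)
        then show ?thesis using den by simp
      qed
      have le2: "R * \<eta> \<le> \<mu> * \<delta>"
      proof -
        have "R * \<eta> \<le> (R + 1) * (\<mu> * \<delta> / (R + 1))"
          using \<eta>q pos \<open>\<eta> > 0\<close> by (intro mult_mono) (auto simp: q_def)
        then show ?thesis using den by simp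
      qed
      have le3: "(R / \<mu> + M) * \<eta> \<le> \<rho>"
      proof -
        have "(R / \<mu> + M) * \<eta> \<le> W * (\<rho> / W)"
          using \<eta>q pos \<open>\<eta> > 0\<close> den by (intro mult_mono) (auto simp: q_def W_def)
        then show ?thesis using den by simp
      qed
      define u where "u = dither m v \<epsilon>"
      define B where "B = \<epsilon> powr (1 / real m - 1) * C"
      have "B > 0" using \<open>\<epsilon> > 0\<close> C(2) by (simp add: B_def)
      have um: "u k \<in> borel_measurable lebesgue" if "k \<in> {1, 2}" for k
        unfolding u_def by (rule dither_measurable) (rule v[OF that])
      have uB: "\<bar>u k t\<bar> \<le> B" if "k \<in> {1, 2}" for k t
        unfolding u_def dither_def B_def abs_mult using C(1)[OF that] by (intro mult_mono) auto
      have uper: "u k (t + real n * \<epsilon>) = u k t" if "k \<in> {1, 2}" for k t n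
        unfolding u_def by (rule dither_add_period[OF _ \<open>\<epsilon> > 0\<close>]) (rule per[OF that])
      \<comment> \<open>The amplitude bound \<open>B\<close> alone does not have to be small; all
        estimates see only its product with the period.\<close>
      have B\<epsilon>: "B * \<epsilon> = C * \<eta>"
        using \<open>\<epsilon> > 0\<close> by (simp add: B_def \<eta>_def powr_diff)
      obtain x where x: "\<And>t. t \<ge> 0 \<Longrightarrow> x t = x0 + integral {0..t} (\<lambda>s. control_field G u s (clamp (x s)))"
        and xlip: "\<And>s t. s \<ge> 0 \<Longrightarrow> t \<ge> 0 \<Longrightarrow> \<bar>x s - x t\<bar> \<le> 2 * B * N * \<bar>s - t\<bar>"
        and xint: "\<And>T. (\<lambda>s. control_field G u s (clamp (x s))) integrable_on {0..T}"
      proof -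
        have "\<exists>x. (\<forall>t\<ge>0. x t = x0 + integral {0..t} (\<lambda>s. control_field G u s (clamp (x s)))) \<and>
            (\<forall>s\<ge>0. \<forall>t\<ge>0. \<bar>x s - x t\<bar> \<le> 2 * B * N * \<bar>s - t\<bar>) \<and>
            (\<forall>T. (\<lambda>s. control_field G u s (clamp (x s))) integrable_on {0..T})"
          unfolding clamp_def
          by (rule clamped_integral_equation_exists[OF \<open>a \<le> b\<close> _ _ \<open>B > 0\<close> _ L(1)])
             (rule um uB N(2) L(2); assumption)+
        then show thesis
        proof (elim exE conjE)
          fix x
          assume 1: "\<forall>t\<ge>0. x t = x0 + integral {0..t} (\<lambda>s. control_field G u s (clamp (x s)))"
            and 2: "\<forall>s\<ge>0. \<forall>t\<ge>0. \<bar>x s - x t\<bar> \<le> 2 * B * N * \<bar>s - t\<bar>"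
            and 3: "\<forall>T. (\<lambda>s. control_field G u s (clamp (x s))) integrable_on {0..T}"
          show thesis by (rule that[of x]) (use 1 2 3 in blast)+
        qed
      qed
      have x_0: "x 0 = x0" using x[of 0] by simp
      have xc: "continuous_on {0..} x"
        by (rule continuous_on_lipschitz_real) (use xlip in auto)
      have near: "\<bar>x (s + t) - x t\<bar> \<le> M * \<eta>" if "s \<in> {0..\<epsilon>}" "t \<ge> 0" for s t
      proof -
        have "\<bar>x (s + t) - x t\<bar> \<le> 2 * B * N * \<bar>s\<bar>" using xlip[of "s + t" t] that by simp
        also have "\<dots> \<le> 2 * B * N * \<epsilon>" using that \<open>B > 0\<close> N(1) by (intro mult_left_mono) auto
        also have "\<dots> = 2 * N * (B * \<epsilon>)" by simp
        finally show ?thesis unfolding B\<epsilon> M_def by (simp add: mult_ac)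
      qed
      have clampK: "clamp z = z" if "z \<in> {a..b}" for z using that by (auto simp: clamp_def)
      \<comment> \<open>From a start within \<delta>, \<open>near\<close> and the margin keep the
        whole period inside the interval from a to b. The clamp is inactive there and the expansion
        applies to the original fields.\<close>
      have step: "\<bar>x (real (Suc n) * \<epsilon>) - xs\<bar> \<le> (1 - \<epsilon> * \<mu>) * \<bar>x (real n * \<epsilon>) - xs\<bar> + R * \<epsilon> * \<eta>"
        if n: "\<bar>x (real n * \<epsilon>) - xs\<bar> \<le> \<delta>" for n
      proof -
        define t where "t = real n * \<epsilon>"
        define z where "z = x t"
        have "t \<ge> 0" using \<open>\<epsilon> > 0\<close> by (simp add: t_def)
        have zK: "z \<in> {a..b}" using n r(1) unfolding inK z_def t_def by simp
        then have "z \<in> D" using KD by blast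
        have xK: "x (s + t) \<in> {a..b}" if "s \<in> {0..\<epsilon>}" for s
          using near[OF that \<open>t \<ge> 0\<close>] n le1 unfolding inK t_def by linarith
        have shift: "x (s + t) = z + integral {0..s} (\<lambda>s. \<Sum>k\<in>{1, 2}. u k s * G k (x (s + t)))"
          if s: "s \<in> {0..\<epsilon>}" for s
        proof -
          have "x (s + t) = z + integral {0..s} (\<lambda>s. control_field G u s (clamp (x (s + t))))"
            unfolding z_def
            by (rule control_integral_shift[of x x0 G u "\<lambda>s. clamp (x s)"])
               (use x xint uper s \<open>t \<ge> 0\<close> in \<open>auto simp: t_def\<close>)
          also have "integral {0..s} (\<lambda>s. control_field G u s (clamp (x (s + t)))) =
            integral {0..s} (\<lambda>s. \<Sum>k\<in>{1, 2}. u k s * G k (x (s + t)))"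
          proof (rule integral_cong)
            fix s' assume "s' \<in> {0..s}"
            then have "x (s' + t) \<in> {a..b}" using s by (intro xK) auto
            then show "control_field G u s' (clamp (x (s' + t))) = (\<Sum>k\<in>{1, 2}. u k s' * G k (x (s' + t)))"
              by (simp only: clampK control_field_def)
          qed
          finally show ?thesis .
        qed
        have sc: "continuous_on {0..\<epsilon>} (\<lambda>s. x (s + t))"
          by (rule continuous_on_compose2[OF xc]) (use \<open>t \<ge> 0\<close> in \<open>auto intro!: continuous_intros\<close>)
        have "\<epsilon> \<in> {0..\<epsilon>}" using \<open>\<epsilon> > 0\<close> by simp
        have "\<bar>x (\<epsilon> + t) - (z + chen_fliess m G u \<epsilon> z)\<bar> \<le> A * (2 * B * \<epsilon>) ^ Suc m"
        proof (rule chen_fliess_remainder[OF \<open>open D\<close> KD convex_real_interval(5) compact_Icc _ _ _ sc])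
          show "\<bar>iterated_lie G ks z\<bar> \<le> A" if "set ks \<subseteq> {1, 2}" "length ks = Suc m" "z \<in> {a..b}" for ks z
            using A' that by simp
        qed (rule G um uB xK shift \<open>\<epsilon> \<in> {0..\<epsilon>}\<close>; assumption)+
        also have "2 * B * \<epsilon> = 2 * C * \<eta>" using B\<epsilon> by (simp add: mult.assoc)
        \<comment> \<open>Of the m + 1 factors \<eta>, m combine to \<epsilon>; the remaining one
          makes the error small relative to the drift.\<close>
        also have "A * (2 * C * \<eta>) ^ Suc m = R * \<epsilon> * \<eta>"
          unfolding R_def power_mult_distrib power_Suc[of \<eta>] \<eta>m by (simp only: mult_ac)
        also have "chen_fliess m G u \<epsilon> z = - (\<epsilon> * cm * p z)"
          unfolding u_def by (rule cf) fact+
        finally have 1: "\<bar>x (\<epsilon> + t) - (z - \<epsilon> * cm * p z)\<bar> \<le> R * \<epsilon> * \<eta>" by simp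
        have "\<bar>(z - xs) - (\<epsilon> * cm) * p z\<bar> \<le> (1 - (\<epsilon> * cm) * \<beta>1) * \<bar>z - xs\<bar>"
          by (rule gradient_step_contraction[OF p1 p2 _ \<epsilon>2])
             (use \<open>z \<in> D\<close> \<open>\<epsilon> > 0\<close> \<open>cm > 0\<close> in auto)
        then have 2: "\<bar>(z - xs) - \<epsilon> * cm * p z\<bar> \<le> (1 - \<epsilon> * \<mu>) * \<bar>z - xs\<bar>"
          by (simp add: \<mu>_def mult.assoc)
        have "real (Suc n) * \<epsilon> = \<epsilon> + t" by (simp add: t_def algebra_simps)
        then show ?thesis using 1 2 unfolding t_def[symmetric] z_def[symmetric] by simp
      qed
      \<comment> \<open>The first conjunct licenses the next application of \<open>step\<close>. In
        the second, \<open>R / \<mu> * \<eta>\<close> is the fixed point of the recursion that maps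
        e to (1 - \<epsilon> \<mu>) e + R \<epsilon> \<eta>.\<close>
      have iter: "\<bar>x (real n * \<epsilon>) - xs\<bar> \<le> \<delta> \<and>
        \<bar>x (real n * \<epsilon>) - xs\<bar> \<le> (1 - \<epsilon> * \<mu>) ^ n * \<bar>x0 - xs\<bar> + R / \<mu> * \<eta>" for n
      proof (induction n)
        case 0
        have "0 \<le> R / \<mu> * \<eta>" using pos \<open>\<eta> > 0\<close> by simp
        then show ?case using x0 x_0 by (simp add: dist_real_def abs_minus_commute)
      next
        case (Suc n)
        let ?e = "\<bar>x (real n * \<epsilon>) - xs\<bar>"
        have st: "\<bar>x (real (Suc n) * \<epsilon>) - xs\<bar> \<le> (1 - \<epsilon> * \<mu>) * ?e + R * \<epsilon> * \<eta>"
          using Suc by (intro step) simp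
        have nn: "0 \<le> 1 - \<epsilon> * \<mu>" using \<epsilon>3 by simp
        have "(1 - \<epsilon> * \<mu>) * ?e \<le> (1 - \<epsilon> * \<mu>) * \<delta>" using Suc nn by (intro mult_left_mono) auto
        moreover have "\<epsilon> * (R * \<eta>) \<le> \<epsilon> * (\<mu> * \<delta>)" using le2 \<open>\<epsilon> > 0\<close> by (intro mult_left_mono) auto
        ultimately have 1: "(1 - \<epsilon> * \<mu>) * ?e + R * \<epsilon> * \<eta> \<le> \<delta>" by (simp add: algebra_simps)
        have "(1 - \<epsilon> * \<mu>) * ?e \<le> (1 - \<epsilon> * \<mu>) * ((1 - \<epsilon> * \<mu>) ^ n * \<bar>x0 - xs\<bar> + R / \<mu> * \<eta>)"
          using Suc nn by (intro mult_left_mono) auto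
        also have "\<dots> = (1 - \<epsilon> * \<mu>) ^ Suc n * \<bar>x0 - xs\<bar> + R / \<mu> * \<eta> - R * \<epsilon> * \<eta>"
          using pos(1) by (simp add: field_simps)
        finally show ?case using st 1 by linarith
      qed
      have global: "\<exists>n s. s \<in> {0..\<epsilon>} \<and> t = s + real n * \<epsilon>" if "t \<ge> 0" for t
      proof -
        define n where "n = nat \<lfloor>t / \<epsilon>\<rfloor>"
        have "real n = of_int \<lfloor>t / \<epsilon>\<rfloor>" using that \<open>\<epsilon> > 0\<close> by (simp add: n_def)
        then have "real n \<le> t / \<epsilon>" "t / \<epsilon> \<le> real n + 1" by linarith+
        then have "real n * \<epsilon> \<le> t" "t \<le> real n * \<epsilon> + \<epsilon>" using \<open>\<epsilon> > 0\<close> by (auto simp: field_simps)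
        then show ?thesis by (intro exI[of _ n] exI[of _ "t - real n * \<epsilon>"]) auto
      qed
      have xK: "x t \<in> {a..b}" if t0: "t \<ge> 0" for t
      proof -
        obtain n s where s: "s \<in> {0..\<epsilon>}" "t = s + real n * \<epsilon>" using global[OF t0] by blast
        have "\<bar>x t - x (real n * \<epsilon>)\<bar> \<le> M * \<eta>"
          unfolding s(2) using s(1) \<open>\<epsilon> > 0\<close> by (intro near) auto
        then show ?thesis using iter[of n] le1 unfolding inK by linarith
      qed
      have bound: "\<bar>x t - xs\<bar> \<le> exp \<mu> * \<bar>x0 - xs\<bar> * exp (- \<mu> * t) + \<rho>" if t0: "t \<ge> 0" for t
      proof -
        obtain n s where s: "s \<in> {0..\<epsilon>}" "t = s + real n * \<epsilon>" using global[OF t0] by blast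
        have near': "\<bar>x t - x (real n * \<epsilon>)\<bar> \<le> M * \<eta>"
          unfolding s(2) using s(1) \<open>\<epsilon> > 0\<close> by (intro near) auto
        have "1 - \<epsilon> * \<mu> \<le> exp (- (\<epsilon> * \<mu>))" using exp_ge_add_one_self[of "- (\<epsilon> * \<mu>)"] by simp
        then have "(1 - \<epsilon> * \<mu>) ^ n \<le> exp (- (\<epsilon> * \<mu>)) ^ n" using \<epsilon>3 by (intro power_mono) auto
        also have "\<dots> = exp (- \<mu> * (real n * \<epsilon>))" by (simp add: exp_of_nat_mult[symmetric] mult_ac)
        also have "\<dots> \<le> exp (\<mu> + - \<mu> * t)"
        proof -
          have "\<mu> * s \<le> \<mu> * 1" using s(1) \<epsilon>le(1) pos(1) by (intro mult_left_mono) auto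
          then show ?thesis by (simp add: s(2) algebra_simps)
        qed
        also have "\<dots> = exp \<mu> * exp (- \<mu> * t)" by (rule exp_add)
        finally have "(1 - \<epsilon> * \<mu>) ^ n * \<bar>x0 - xs\<bar> \<le> exp \<mu> * exp (- \<mu> * t) * \<bar>x0 - xs\<bar>"
          by (rule mult_right_mono) simp
        moreover have "R / \<mu> * \<eta> + M * \<eta> \<le> \<rho>" using le3 by (simp add: distrib_right)
        ultimately have "\<bar>x t - xs\<bar> \<le> exp \<mu> * exp (- \<mu> * t) * \<bar>x0 - xs\<bar> + \<rho>"
          using near' iter[of n] by linarith
        then show ?thesis by (simp only: mult_ac)
      qed
      have eq: "x t = x0 + integral {0..t} (\<lambda>s. control_field G u s (x s))" if "t \<ge> 0" for t
      proof -
        have "integral {0..t} (\<lambda>s. control_field G u s (clamp (x s))) = integral {0..t} (\<lambda>s. control_field G u s (x s))"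
        proof (rule integral_cong)
          fix s assume "s \<in> {0..t}"
          then have "x s \<in> {a..b}" by (intro xK) simp
          then show "control_field G u s (clamp (x s)) = control_field G u s (x s)" by (simp only: clampK)
        qed
        then show ?thesis using x[OF that] by simp
      qed
      have "global_solution (control_field G u) D x0 x"
        by (rule control_global_solution[OF assms(1,2) _ _ _ \<open>B > 0\<close> KD compact_Icc _ xc])
           (rule G' um uB xK eq; assumption)+
      then show "\<exists>x. global_solution (control_field G (dither m v \<epsilon>)) D x0 x \<and>
              (\<forall>t\<ge>0. \<bar>x t - xs\<bar> \<le> exp \<mu> * \<bar>x0 - xs\<bar> * exp (- \<mu> * t) + \<rho>)"
        using bound unfolding u_def by blast
    qed fact
  qed (fact pos(1))
qed

section \<open>Essentially bounded dithers\<close>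

text \<open>The exceptional null set must not depend on the state, which varies with time along the
  solution; hence the quantifier over z inside \<open>AE\<close>.\<close>

lemma caratheodory_solution_cong_AE:
  assumes "AE t in lebesgue. \<forall>z. F t z = F' t z"
  shows "caratheodory_solution F D I x = caratheodory_solution F' D I x"
proof -
  have "AE t in lebesgue. (t \<in> I \<longrightarrow> (x has_real_derivative F t (x t)) (at t within I)) \<longleftrightarrow>
    (t \<in> I \<longrightarrow> (x has_real_derivative F' t (x t)) (at t within I))"
    using assms by eventually_elim simp
  then have "(AE t in lebesgue. t \<in> I \<longrightarrow> (x has_real_derivative F t (x t)) (at t within I)) \<longleftrightarrow>
    (AE t in lebesgue. t \<in> I \<longrightarrow> (x has_real_derivative F' t (x t)) (at t within I))"
    by (rule eventually_subst)
  then show ?thesis by (simp add: caratheodory_solution_def)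
qed

text \<open>Only the representative \<open>u\<close> is measurable and bounded by hypothesis;
  \<open>w\<close> inherits absolute integrability by changing the integrand on a null set.\<close>

lemma iterated_integral_cong_AE:
  assumes u: "\<And>k. k \<in> A \<Longrightarrow> u k \<in> borel_measurable lebesgue"
    and B: "\<And>k t. k \<in> A \<Longrightarrow> \<bar>u k t\<bar> \<le> B"
    and ae: "\<And>k. k \<in> A \<Longrightarrow> AE t in lebesgue. w k t = u k t"
  shows "set ks \<subseteq> A \<Longrightarrow> iterated_integral w ks t = iterated_integral u ks t"
proof (induction ks arbitrary: t)
  case (Cons k ks)
  then have k: "k \<in> A" and IH: "iterated_integral w ks = iterated_integral u ks" by auto
  let ?N = "{t. w k t \<noteq> u k t}"
  let ?f = "\<lambda>s. u k s * iterated_integral u ks s"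
  let ?g = "\<lambda>s. w k s * iterated_integral u ks s"
  have N: "negligible ?N" using ae[OF k] by (simp add: AE_lebesgue_negligible)
  have "continuous_on {0..t} (iterated_integral u ks)"
    by (rule iterated_integral_continuous[where A = A and B = B]) (use u B Cons.prems in auto)
  then have f: "?f absolutely_integrable_on {0..t}"
    using u[OF k] B[OF k] by (rule integrable_continuous_mult_bounded(1))
  have g: "?g absolutely_integrable_on {0..t}"
    by (rule absolutely_integrable_spike[OF f N]) auto
  have "(LINT s:{0..t}|lebesgue. ?g s) = integral {0..t} ?g"
    by (rule set_lebesgue_integral_eq_integral(2)[OF g])
  also have "\<dots> = integral {0..t} ?f"
    by (rule integral_spike[OF N]) auto
  also have "\<dots> = (LINT s:{0..t}|lebesgue. ?f s)"
    by (rule set_lebesgue_integral_eq_integral(2)[OF f, symmetric])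
  finally show ?case by (simp add: IH)
qed simp

text \<open>The exceptional times of the dither lie in the exceptional set of \<open>v k\<close>
  scaled by \<epsilon>, and scaling preserves null sets.\<close>

lemma dither_cong_AE:
  assumes "AE t in lebesgue. v k t = w k t" "\<epsilon> > 0"
  shows "AE t in lebesgue. dither m v \<epsilon> k t = dither m w \<epsilon> k t"
proof -
  have "negligible ((\<lambda>t. \<epsilon> * t) ` {t. v k t \<noteq> w k t})"
    using assms(1)
    by (intro negligible_differentiable_image_negligible)
       (auto simp: AE_lebesgue_negligible intro!: derivative_intros)
  moreover have "{t. dither m v \<epsilon> k t \<noteq> dither m w \<epsilon> k t} \<subseteq> (\<lambda>t. \<epsilon> * t) ` {t. v k t \<noteq> w k t}"
  proof
    fix t assume "t \<in> {t. dither m v \<epsilon> k t \<noteq> dither m w \<epsilon> k t}"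
    then have "t / \<epsilon> \<in> {t. v k t \<noteq> w k t}" by (auto simp: dither_def)
    then show "t \<in> (\<lambda>t. \<epsilon> * t) ` {t. v k t \<noteq> w k t}"
      using \<open>\<epsilon> > 0\<close> by (intro image_eqI[of _ _ "t / \<epsilon>"]) auto
  qed
  ultimately show ?thesis unfolding AE_lebesgue_negligible by (rule negligible_subset)
qed

theorem theorem1:
  fixes D :: "real set" and m :: nat and xs :: real and J :: "real \<Rightarrow> real"
    and g v :: "nat \<Rightarrow> real \<Rightarrow> real"
    and \<alpha>1 \<alpha>2 \<beta>1 \<beta>2 cm :: real
  assumes "open D" and "is_interval D" and "D \<noteq> {}" and "m \<ge> 2" and "xs \<in> D"
    and "Ck_on m D J"
    and "\<alpha>1 > 0" and "\<alpha>2 > 0" and "\<beta>1 > 0" and "\<beta>2 > 0"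
    and "\<And>x. x \<in> D \<Longrightarrow>
           \<alpha>1 * \<bar>x - xs\<bar> ^ m \<le> J x - J xs \<and> J x - J xs \<le> \<alpha>2 * \<bar>x - xs\<bar> ^ m"
    and "\<And>x. x \<in> D \<Longrightarrow> (deriv ^^ (m - 1)) J x * (x - xs) \<ge> \<beta>1 * \<bar>x - xs\<bar>\<^sup>2"
    and "\<And>x. x \<in> D \<Longrightarrow> \<bar>(deriv ^^ (m - 1)) J x\<bar> \<le> \<beta>2 * \<bar>x - xs\<bar>"
    and "Ck_on m D (g 1 \<circ> J)" and "Ck_on m D (g 2 \<circ> J)"
    and "cm > 0"
    and "\<And>x. x \<in> D \<Longrightarrow>
           right_iterated_bracket (m - 1) (g 1 \<circ> J) (g 2 \<circ> J) x = - cm * (deriv ^^ (m - 1)) J x"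
    and "\<And>k. k \<in> {1, 2} \<Longrightarrow> v k \<in> borel_measurable lebesgue"
    and "\<And>k. k \<in> {1, 2} \<Longrightarrow> \<exists>C. AE t in lebesgue. \<bar>v k t\<bar> \<le> C"
    and "\<And>k t. k \<in> {1, 2} \<Longrightarrow> v k (t + 1) = v k t"
    and "\<And>\<epsilon> x0. \<epsilon> > 0 \<Longrightarrow> x0 \<in> D \<Longrightarrow>
           chen_fliess m (\<lambda>k. g k \<circ> J) (dither m v \<epsilon>) \<epsilon> x0 =
             \<epsilon> * right_iterated_bracket (m - 1) (g 1 \<circ> J) (g 2 \<circ> J) x0"
  shows "semiglobally_practically_exp_stable D xs
           (\<lambda>\<epsilon> t x. g 1 (J x) * dither m v \<epsilon> 1 t + g 2 (J x) * dither m v \<epsilon> 2 t)"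
proof -
  let ?G = "\<lambda>k. g k \<circ> J"
  obtain C1 C2 where "AE t in lebesgue. \<bar>v 1 t\<bar> \<le> C1" "AE t in lebesgue. \<bar>v 2 t\<bar> \<le> C2"
    using assms(19)[of 1] assms(19)[of 2] by auto
  define C where "C = max 1 (max C1 C2)"
  \<comment> \<open>Truncating by the value of \<open>v k t\<close> keeps the period exact and the
    function measurable, and gives a bound at every time; the 1 in \<open>C\<close> makes that bound
    positive.\<close>
  define w where "w k t = (if \<bar>v k t\<bar> \<le> C then v k t else 0)" for k t
  have vw: "AE t in lebesgue. v k t = w k t" if "k \<in> {1, 2}" for k
  proof -
    have "AE t in lebesgue. \<bar>v 1 t\<bar> \<le> C1 \<and> \<bar>v 2 t\<bar> \<le> C2"
      using \<open>AE t in lebesgue. \<bar>v 1 t\<bar> \<le> C1\<close> \<open>AE t in lebesgue. \<bar>v 2 t\<bar> \<le> C2\<close> by (rule AE_conjI)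
    then show ?thesis by eventually_elim (use that in \<open>auto simp: w_def C_def\<close>)
  qed
  have "C > 0" by (simp add: C_def)
  have wm: "w k \<in> borel_measurable lebesgue" if "k \<in> {1, 2}" for k
    using assms(18)[OF that] unfolding w_def[abs_def] by measurable
  have wC: "\<bar>w k t\<bar> \<le> C" if "k \<in> {1, 2}" for k t
    using \<open>C > 0\<close> by (simp add: w_def)
  have wper: "w k (t + 1) = w k t" if "k \<in> {1, 2}" for k t
    using assms(20)[OF that] by (simp add: w_def)
  have dw: "AE t in lebesgue. dither m v \<epsilon> k t = dither m w \<epsilon> k t" if "\<epsilon> > 0" "k \<in> {1, 2}" for \<epsilon> k
    using vw[OF that(2)] that(1) by (rule dither_cong_AE)
  have dwB: "\<bar>dither m w \<epsilon> k t\<bar> \<le> \<epsilon> powr (1 / real m - 1) * C" if "k \<in> {1, 2}" for \<epsilon> k t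
    unfolding dither_def abs_mult using wC[OF that] by (intro mult_mono) auto
  have cf: "chen_fliess m ?G (dither m w \<epsilon>) \<epsilon> x0 = - (\<epsilon> * cm * (deriv ^^ (m - 1)) J x0)"
    if "\<epsilon> > 0" "x0 \<in> D" for \<epsilon> x0
  proof -
    have "iterated_integral (dither m v \<epsilon>) ks \<epsilon> = iterated_integral (dither m w \<epsilon>) ks \<epsilon>"
      if "set ks \<subseteq> {1, 2}" for ks
      by (rule iterated_integral_cong_AE[OF _ _ _ that])
         (rule dither_measurable, erule wm, erule dwB, erule dw[OF \<open>\<epsilon> > 0\<close>])
    then have "chen_fliess m ?G (dither m w \<epsilon>) \<epsilon> x0 = chen_fliess m ?G (dither m v \<epsilon>) \<epsilon> x0"
      unfolding chen_fliess_def by (intro sum.cong refl) auto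
    then show ?thesis using assms(21)[OF that] assms(17)[OF that(2)] by simp
  qed
  have st: "semiglobally_practically_exp_stable D xs (\<lambda>\<epsilon>. control_field ?G (dither m w \<epsilon>))"
  proof (rule bounded_dither_stability[OF assms(1,2)])
    show "1 \<le> m" using assms(4) by simp
    show "Ck_on m D (?G k)" if "k \<in> {1, 2}" for k using that assms(14,15) by auto
  qed (rule wm wC wper \<open>C > 0\<close> assms(9,10,16) assms(12,13) cf; assumption)+
  \<comment> \<open>Both systems have literally the same global solutions for every positive
    \<epsilon>, so stability transfers with unchanged constants.\<close>
  have gs: "global_solution (\<lambda>t x. g 1 (J x) * dither m v \<epsilon> 1 t + g 2 (J x) * dither m v \<epsilon> 2 t) D x0 x =
      global_solution (control_field ?G (dither m w \<epsilon>)) D x0 x" if "\<epsilon> > 0" for \<epsilon> x0 x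
  proof -
    have "AE t in lebesgue. dither m v \<epsilon> 1 t = dither m w \<epsilon> 1 t \<and> dither m v \<epsilon> 2 t = dither m w \<epsilon> 2 t"
      using dw[OF that] by (intro AE_conjI) auto
    then have "AE t in lebesgue. \<forall>x. g 1 (J x) * dither m v \<epsilon> 1 t + g 2 (J x) * dither m v \<epsilon> 2 t =
       control_field ?G (dither m w \<epsilon>) t x"
      by eventually_elim (simp add: control_field_def)
    from caratheodory_solution_cong_AE[OF this] show ?thesis
      unfolding global_solution_def by simp
  qed
  show ?thesis
    unfolding semiglobally_practically_exp_stable_def
  proof (intro allI impI)
    fix \<delta> :: real assume "\<delta> > 0" "closure (ball xs \<delta>) \<subseteq> D"
    then obtain c \<mu> where c: "c > 0" "\<mu> > 0"
      "\<forall>\<rho>\<in>{0<..<\<delta>}. \<exists>\<epsilon>0>0. \<forall>\<epsilon>\<in>{0<..\<epsilon>0}. \<forall>x0\<in>ball xs \<delta>.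
          \<exists>x. global_solution (control_field ?G (dither m w \<epsilon>)) D x0 x \<and>
              (\<forall>t\<ge>0. \<bar>x t - xs\<bar> \<le> c * \<bar>x0 - xs\<bar> * exp (- \<mu> * t) + \<rho>)"
      by (rule st[unfolded semiglobally_practically_exp_stable_def, THEN spec, THEN mp, THEN mp, elim_format])
         (elim exE conjE)
    show "\<exists>c>0. \<exists>\<mu>>0. \<forall>\<rho>\<in>{0<..<\<delta>}. \<exists>\<epsilon>0>0. \<forall>\<epsilon>\<in>{0<..\<epsilon>0}. \<forall>x0\<in>ball xs \<delta>.
          \<exists>x. global_solution (\<lambda>t x. g 1 (J x) * dither m v \<epsilon> 1 t + g 2 (J x) * dither m v \<epsilon> 2 t) D x0 x \<and>
              (\<forall>t\<ge>0. \<bar>x t - xs\<bar> \<le> c * \<bar>x0 - xs\<bar> * exp (- \<mu> * t) + \<rho>)"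
    proof (rule exI[of _ c], intro conjI, rule c(1), rule exI[of _ \<mu>], intro conjI ballI, rule c(2))
      fix \<rho> assume "\<rho> \<in> {0<..<\<delta>}"
      from bspec[OF c(3) this] obtain \<epsilon>0 where "\<epsilon>0 > 0" and \<epsilon>0: "\<forall>\<epsilon>\<in>{0<..\<epsilon>0}. \<forall>x0\<in>ball xs \<delta>.
          \<exists>x. global_solution (control_field ?G (dither m w \<epsilon>)) D x0 x \<and>
              (\<forall>t\<ge>0. \<bar>x t - xs\<bar> \<le> c * \<bar>x0 - xs\<bar> * exp (- \<mu> * t) + \<rho>)"
        by (elim exE conjE)
      show "\<exists>\<epsilon>0>0. \<forall>\<epsilon>\<in>{0<..\<epsilon>0}. \<forall>x0\<in>ball xs \<delta>.
          \<exists>x. global_solution (\<lambda>t x. g 1 (J x) * dither m v \<epsilon> 1 t + g 2 (J x) * dither m v \<epsilon> 2 t) D x0 x \<and>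
              (\<forall>t\<ge>0. \<bar>x t - xs\<bar> \<le> c * \<bar>x0 - xs\<bar> * exp (- \<mu> * t) + \<rho>)"
      proof (rule exI[of _ \<epsilon>0], intro conjI ballI, rule \<open>\<epsilon>0 > 0\<close>)
        fix \<epsilon> x0 assume \<epsilon>: "\<epsilon> \<in> {0<..\<epsilon>0}" and x0: "x0 \<in> ball xs \<delta>"
        then have "\<epsilon> > 0" by simp
        show "\<exists>x. global_solution (\<lambda>t x. g 1 (J x) * dither m v \<epsilon> 1 t + g 2 (J x) * dither m v \<epsilon> 2 t) D x0 x \<and>
              (\<forall>t\<ge>0. \<bar>x t - xs\<bar> \<le> c * \<bar>x0 - xs\<bar> * exp (- \<mu> * t) + \<rho>)"
          unfolding gs[OF \<open>\<epsilon> > 0\<close>] by (rule bspec[OF bspec[OF \<epsilon>0 \<epsilon>] x0])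
      qed
    qed
  qed
qed

end
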